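(* Let $\Omega_1,\Omega_2\subset\mathbb{R}^n$ be compact, let $\lambda_i$ be a finite non-negative Radon measure on $\Omega_i$ with $\operatorname{spt}\lambda_i=\Omega_i$ ($i=1,2$), and put $\Omega=\Omega_1\times\Omega_2$, $\lambda=\lambda_1\otimes\lambda_2$. Let $c:\Omega\to\mathbb{R}$ be continuous, let $\gamma>0$, and let $\Phi$ be a quasi-Young's function with $\lim_{t\to\infty}\Phi(t)/t=\infty$. For $i=1,2$ let $\mu_i$ be a probability measure on $\Omega_i$ with $\mu_i\ll\lambda_i$ such that $\Phi\big(\tfrac{\mathrm{d}\mu_i}{\mathrm{d}\lambda_i}\big)$ is integrable with respect to $\lambda_i$. Assume that $(\Phi_\infty)^*\big(\tfrac{-c}{\gamma}\big)$ is integrable with respect to $\lambda$ and that the implication $$\frac{\mathrm{d}\mu_i}{\mathrm{d}\lambda_i}\in L^\Phi(\Omega_i,\mathrm{d}\lambda_i),\ i=1,2\quad\Longrightarrow\quad \frac{\mathrm{d}(\mu_1\otimes\mu_2)}{\mathrm{d}\lambda}\in L^\Phi(\Omega,\mathrm{d}\lambda)$$ holds. Then the problem $$\inf_{\substack{\pi\in\mathcal{P}(\Omega),\ \pi\ll\lambda\\ (P_i)_\#\pi=\mu_i,\ i=1,2}}\ \int_\Omega c\,\mathrm{d}\pi+\gamma\int_\Omega \Phi_\infty\Big(\frac{\mathrm{d}\pi}{\mathrm{d}\lambda}\Big)\,\mathrm{d}\lambda$$ admits a minimizer $\bar\pi$ if and only if $\tfrac{\mathrm{d}\mu_i}{\mathrm{d}\lambda_i}\in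 L^\Phi(\Omega_i,\mathrm{d}\lambda_i)$ for $i=1,2$. In this case $\bar\pi\in L^\Phi(\Omega,\mathrm{d}\lambda)$ (in the sense that the density $\tfrac{\mathrm{d}\bar\pi}{\mathrm{d}\lambda}$ lies in this space), and the minimizer is unique if $\Phi$ is strictly convex.
   Context: $\mathcal{P}(\Omega)$ denotes the probability (Radon) measures on $\Omega$, $P_i:\Omega_1\times\Omega_2\to\Omega_i$ the coordinate projections, $(P_i)_\#\pi$ the $i$-th marginal of $\pi$. A Young's function is a function $\Phi(t)=\int_0^t\varphi(s)\,\mathrm{d}s$, $t\ge0$, where $\varphi:[0,\infty)\to[0,\infty]$ is increasing (in the weak sense) and lower semi-continuous with $\varphi(0)=0$ and is neither identically zero nor identically infinite on $(0,\infty)$. A quasi-Young's function is a convex, lower semi-continuous $\Phi:[0,\infty)\to\mathbb{R}\cup\{\infty\}$ such that $\Phi_+=\max(\Phi,0)$ is a Young's function. For $g:[0,\infty)\to\mathbb{R}\cup\{\infty\}$, $g_\infty$ is its extension to $\mathbb{R}$ by $\infty$ on $(-\infty,0)$. A superscript $*$ denotes the convex conjugate. For a (quasi-)Young's function $\Phi$ and a finite measure $\nu$ on a set $X$, the Luxemburg norm of a measurable $f:X\to\mathbb{R}$ is $\|f\|_{L^\Phi(X,\mathrm{d}\nu)}=\inf\{\gamma\ge0\mid\int_X\Phi(|f|/\gamma)\,\mathrm{d}\nu\le1\}$, and the Orlicz space $L^\Phi(X,\mathrm{d}\nu)$ consists of all measurable $f$ with finite Luxemburg norm; for quasi-Young's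 $\Phi$ one has $L^\Phi(X,\mathrm{d}\nu)=L^{\Phi_+}(X,\mathrm{d}\nu)$.
   Formalization: That every minimizer lies in L^Φ, and uniqueness for strictly convex Φ, are stated only if the infimum is finite; otherwise every feasible π counts as a minimizer and both claims can fail. The equivalence and existence of a minimizer in L^Φ are stated without this condition. *)

theory Defs
  imports "HOL-Probability.Probability"
begin

text \<open>
  A function on \<open>[0, \<infinity>)\<close> is a function on \<^typ>\<open>real\<close> whose values at negative arguments are
  irrelevant; every definition below restricts to \<open>{0..}\<close> where this matters.
\<close>

section \<open>Convex analysis on the half line\<close>

definition lsc_on :: "real set \<Rightarrow> (real \<Rightarrow> 'b::complete_linorder) \<Rightarrow> bool" where
  "lsc_on S f \<longleftrightarrow> (\<forall>x\<in>S. f x \<le> Liminf (at x within S) f)"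

definition young :: "(real \<Rightarrow> ereal) \<Rightarrow> bool" where
  "young \<Phi> \<longleftrightarrow> (\<exists>\<phi> :: real \<Rightarrow> ennreal.
     mono_on {0..} \<phi> \<and> lsc_on {0..} \<phi> \<and> \<phi> 0 = 0 \<and>
     \<not> (\<forall>s>0. \<phi> s = 0) \<and> \<not> (\<forall>s>0. \<phi> s = \<infinity>) \<and>
     (\<forall>t\<ge>0. \<Phi> t = enn2ereal (\<integral>\<^sup>+s\<in>{0..t}. \<phi> s \<partial>lborel)))"

definition quasi_young :: "(real \<Rightarrow> ereal) \<Rightarrow> bool" where
  "quasi_young \<Phi> \<longleftrightarrow>
     (\<forall>t\<ge>0. \<Phi> t \<noteq> -\<infinity>) \<and>
     (\<forall>s\<ge>0. \<forall>t\<ge>0. \<forall>u\<in>{0..1}.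
        \<Phi> ((1 - u) * s + u * t) \<le> ereal (1 - u) * \<Phi> s + ereal u * \<Phi> t) \<and>
     lsc_on {0..} \<Phi> \<and>
     young (\<lambda>t. max (\<Phi> t) 0)"

text \<open>As usual for extended-valued functions, strictness is required on the effective domain only.\<close>

definition strictly_convex :: "(real \<Rightarrow> ereal) \<Rightarrow> bool" where
  "strictly_convex \<Phi> \<longleftrightarrow>
     (\<forall>s\<ge>0. \<forall>t\<ge>0. \<forall>u\<in>{0<..<1}. s \<noteq> t \<longrightarrow> \<Phi> s < \<infinity> \<longrightarrow> \<Phi> t < \<infinity> \<longrightarrow>
        \<Phi> ((1 - u) * s + u * t) < ereal (1 - u) * \<Phi> s + ereal u * \<Phi> t)"

definition extend_inf :: "(real \<Rightarrow> ereal) \<Rightarrow> real \<Rightarrow> ereal" where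
  "extend_inf g t = (if t < 0 then \<infinity> else g t)"

definition convex_conjugate :: "(real \<Rightarrow> ereal) \<Rightarrow> real \<Rightarrow> ereal" where
  "convex_conjugate f s = (SUP t. ereal (s * t) - f t)"

section \<open>Measures and Orlicz spaces\<close>

text \<open>On a compact set \<open>S\<close> in Euclidean space every finite Borel measure is Radon.\<close>

definition finite_measures_on :: "'a::topological_space set \<Rightarrow> 'a measure set" where
  "finite_measures_on S = {M. finite_measure M \<and> sets M = sets (restrict_space borel S)}"

definition prob_measures_on :: "'a::topological_space set \<Rightarrow> 'a measure set" where
  "prob_measures_on S = {M. prob_space M \<and> sets M = sets (restrict_space borel S)}"

definition spt :: "'a::topological_space measure \<Rightarrow> 'a set" where
  "spt M = {x \<in> space M. \<forall>U. open U \<longrightarrow> x \<in> U \<longrightarrow> emeasure M (U \<inter> space M) > 0}"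

definition dens :: "'a measure \<Rightarrow> 'a measure \<Rightarrow> 'a \<Rightarrow> real" where
  "dens \<nu> \<mu> x = enn2real (RN_deriv \<nu> \<mu> x)"

text \<open>
  Integral with values in \<open>[-\<infinity>, \<infinity>]\<close>. The integrands \<open>\<Phi> \<circ> f\<close> used here are bounded below, so that
  on a finite measure space the subtracted term is finite.
\<close>

definition ereal_integral :: "'a measure \<Rightarrow> ('a \<Rightarrow> ereal) \<Rightarrow> ereal" where
  "ereal_integral M g =
     enn2ereal (\<integral>\<^sup>+x. e2ennreal (g x) \<partial>M) - enn2ereal (\<integral>\<^sup>+x. e2ennreal (- g x) \<partial>M)"

definition ereal_integrable :: "'a measure \<Rightarrow> ('a \<Rightarrow> ereal) \<Rightarrow> bool" where
  "ereal_integrable M g \<longleftrightarrow>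
     g \<in> borel_measurable M \<and> (\<integral>\<^sup>+x. e2ennreal \<bar>g x\<bar> \<partial>M) < \<infinity>"

text \<open>
  The scale \<open>\<gamma> = 0\<close> is left out: with \<open>x / 0 = 0\<close> it would be admissible for every \<open>f\<close>, while with
  the intended reading \<open>\<bar>f\<bar> / 0 = \<infinity>\<close> off the zeros of \<open>f\<close> it does not affect the infimum.
  The infimum of the empty set is \<open>\<infinity>\<close>.
\<close>

definition luxemburg_norm :: "(real \<Rightarrow> ereal) \<Rightarrow> 'a measure \<Rightarrow> ('a \<Rightarrow> real) \<Rightarrow> ereal" where
  "luxemburg_norm \<Phi> \<nu> f =
     Inf {ereal \<gamma> | \<gamma>. \<gamma> > 0 \<and> ereal_integral \<nu> (\<lambda>x. \<Phi> (\<bar>f x\<bar> / \<gamma>)) \<le> 1}"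

definition orlicz_space :: "(real \<Rightarrow> ereal) \<Rightarrow> 'a measure \<Rightarrow> ('a \<Rightarrow> real) set" where
  "orlicz_space \<Phi> \<nu> = {f \<in> borel_measurable \<nu>. luxemburg_norm \<Phi> \<nu> f < \<infinity>}"

section \<open>The regularized transport problem\<close>

definition ot_feasible ::
  "'a::topological_space measure \<Rightarrow> 'b::topological_space measure \<Rightarrow> 'a measure \<Rightarrow> 'b measure
   \<Rightarrow> ('a \<times> 'b) measure set" where
  "ot_feasible lam1 lam2 \<mu>1 \<mu>2 =
     {\<pi> \<in> prob_measures_on (space lam1 \<times> space lam2).
        absolutely_continuous (lam1 \<Otimes>\<^sub>M lam2) \<pi> \<and> distr \<pi> lam1 fst = \<mu>1 \<and> distr \<pi> lam2 snd = \<mu>2}"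

definition ot_objective ::
  "(real \<Rightarrow> ereal) \<Rightarrow> real \<Rightarrow> ('a \<times> 'b \<Rightarrow> real) \<Rightarrow> 'a measure \<Rightarrow> 'b measure
   \<Rightarrow> ('a \<times> 'b) measure \<Rightarrow> ereal" where
  "ot_objective \<Phi> \<gamma> c lam1 lam2 \<pi> =
     ereal (\<integral>z. c z \<partial>\<pi>) +
     ereal \<gamma> * ereal_integral (lam1 \<Otimes>\<^sub>M lam2) (\<lambda>z. extend_inf \<Phi> (dens (lam1 \<Otimes>\<^sub>M lam2) \<pi> z))"

text \<open>
  A minimizer is a feasible point at which the objective attains its infimum in \<open>(-\<infinity>, \<infinity>]\<close>. The
  infimum may be \<open>\<infinity>\<close>, in which case every feasible point is a minimizer. This does occur:
  take \<open>lam1\<close>, \<open>lam2\<close> Lebesgue measure on \<open>[0, 1]\<close> and \<open>[0, 1/2]\<close>, \<open>\<Phi> t = exp t - t - 1\<close>, \<open>c = 0\<close>, the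
  densities \<open>f x = 1/4 - 3/4 * ln x\<close> and \<open>g = 2\<close>. Here \<open>\<Phi> \<circ> f\<close> is integrable, the function
  \<open>(x, y) \<mapsto> f x * g y = 2 * f x\<close> belongs to the Orlicz space, but \<open>\<Phi> \<circ> (2 * f)\<close> is not integrable,
  and by Jensen's inequality in \<open>y\<close> every coupling has infinite energy.
\<close>

definition ot_minimizer ::
  "(real \<Rightarrow> ereal) \<Rightarrow> real \<Rightarrow> ('a::topological_space \<times> 'b::topological_space \<Rightarrow> real)
   \<Rightarrow> 'a measure \<Rightarrow> 'b measure \<Rightarrow> 'a measure \<Rightarrow> 'b measure \<Rightarrow> ('a \<times> 'b) measure \<Rightarrow> bool" where
  "ot_minimizer \<Phi> \<gamma> c lam1 lam2 \<mu>1 \<mu>2 =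
     is_arg_min (ot_objective \<Phi> \<gamma> c lam1 lam2) (\<lambda>\<pi>. \<pi> \<in> ot_feasible lam1 lam2 \<mu>1 \<mu>2)"

definition ot_value ::
  "(real \<Rightarrow> ereal) \<Rightarrow> real \<Rightarrow> ('a::topological_space \<times> 'b::topological_space \<Rightarrow> real)
   \<Rightarrow> 'a measure \<Rightarrow> 'b measure \<Rightarrow> 'a measure \<Rightarrow> 'b measure \<Rightarrow> ereal" where
  "ot_value \<Phi> \<gamma> c lam1 lam2 \<mu>1 \<mu>2 =
     (INF \<pi> \<in> ot_feasible lam1 lam2 \<mu>1 \<mu>2. ot_objective \<Phi> \<gamma> c lam1 lam2 \<pi>)"

end

theory Submission
  imports Defs
begin

text \<open>
  The energy of a coupling with density \<open>f\<close> is, up to an additive constant, the integral of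
  \<open>g z (f z) = c z * f z + \<gamma> * \<Phi> (f z) + K\<close>. Superlinear growth of \<open>\<Phi>\<close> and boundedness of \<open>c\<close> allow
  \<open>K\<close> to be chosen so large that \<open>g \<ge> 0\<close>; then \<open>g\<close> is a nonnegative integrand that is convex, lower
  semicontinuous and uniformly superlinear in its second argument (locale \<open>superlinear_energy\<close>).
  Couplings correspond to nonnegative densities whose masses on all cylinders \<open>A \<times> \<Omega>2\<close> and
  \<open>\<Omega>1 \<times> B\<close> are prescribed (\<open>density_feasible_iff\<close>).

  Existence is the direct method, carried out without weak compactness in \<open>L\<^sup>1\<close>. The sets \<open>C k\<close> of
  competitors within \<open>1/k\<close> of the infimum are convex and decreasing. If \<open>f k \<in> C k\<close> nearly
  minimizes the strictly convex functional \<open>\<integral> exp (- f)\<close> over \<open>C k\<close>, then the midpoint of \<open>f j\<close> and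
  \<open>f k\<close> cannot do much better than either of them, and this forces \<open>exp (- f k / 2)\<close> to be Cauchy in
  \<open>L\<^sup>2\<close>. Hence a subsequence of the \<open>f k\<close> converges almost everywhere
  (\<open>nested_midpoint_convex_AE_limit\<close>). The superlinear energy bound prevents mass from escaping
  (\<open>superlinear_bound_keeps_mass\<close>), and Fatou's lemma gives both the marginal constraints
  (\<open>densities_with_masses_AE_limit\<close>) and lower semicontinuity of the energy (\<open>energy_lsc\<close>). Uniqueness
  is the usual midpoint argument (\<open>energy_minimizer_unique\<close>).

  Orlicz membership comes from \<open>\<Phi> 0 \<le> 0\<close> and convexity: \<open>\<Phi> (t / k) \<le> \<Phi> t / k\<close> for \<open>k \<ge> 1\<close>, so that
  finiteness of \<open>\<integral> \<Phi> (f)\<close> implies a finite Luxemburg norm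
  (\<open>orlicz_space_if_positive_part_integrable\<close>). In particular, integrability of \<open>\<Phi>\<close> of the marginal
  densities already puts these densities in the Orlicz spaces, and a coupling of finite objective has
  its density in the Orlicz space. If every coupling has infinite objective, the product coupling is a
  minimizer whose density is in the Orlicz space by the hypothesis on products.
\<close>

section \<open>Almost everywhere limits in decreasing convex families\<close>

lemma exp_midpoint_defect:
  fixes a b :: real
  shows "(exp (- a / 2) - exp (- b / 2))\<^sup>2 = exp (- a) + exp (- b) - 2 * exp (- ((a + b) / 2))"
proof -
  have "exp (- x / 2) * exp (- x / 2) = exp (- x)" for x :: real
    by (simp flip: exp_add)
  moreover have "exp (- a / 2) * exp (- b / 2) = exp (- ((a + b) / 2))"
    by (simp flip: exp_add add: field_simps)
  ultimately show ?thesis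
    by (simp add: power2_eq_square algebra_simps)
qed

text \<open>
  With \<open>J k\<close> the infimum of \<open>\<integral> exp (- f)\<close> over \<open>C k\<close>, the sequence \<open>J\<close> is increasing and bounded. For
  near-minimizers \<open>f i \<in> C i\<close> and \<open>f j \<in> C j \<subseteq> C i\<close>, the midpoint lies in \<open>C i\<close>, so that by
  \<open>exp_midpoint_defect\<close> the squared \<open>L\<^sup>2\<close> distance of \<open>exp (- f i / 2)\<close> and \<open>exp (- f j / 2)\<close> is
  bounded by \<open>J j - J i\<close> plus the errors of the near-minimizers. The limit is taken of
  \<open>exp (- f k / 2)\<close> because the \<open>f k\<close> themselves may still run off to infinity.
\<close>

lemma (in finite_measure) nested_midpoint_convex_AE_convergent:
  fixes C :: "nat \<Rightarrow> ('a \<Rightarrow> real) set"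
  assumes dec: "decseq C" and ne: "\<And>k. C k \<noteq> {}"
    and meas: "\<And>k f. f \<in> C k \<Longrightarrow> f \<in> borel_measurable M"
    and nonneg: "\<And>k f x. f \<in> C k \<Longrightarrow> 0 \<le> f x"
    and mid: "\<And>k f g. f \<in> C k \<Longrightarrow> g \<in> C k \<Longrightarrow> (\<lambda>x. (f x + g x) / 2) \<in> C k"
  obtains f where "\<And>k. f k \<in> C k" and "AE x in M. convergent (\<lambda>k. exp (- f k x / 2))"
proof -
  define I where "I f = (\<integral>x. exp (- f x) \<partial>M)" for f :: "'a \<Rightarrow> real"
  have intI: "integrable M (\<lambda>x. exp (- f x))" "integrable M (\<lambda>x. exp (- f x / 2))" if "f \<in> C k" for f k
  proof -
    note meas[OF that, measurable]
    show "integrable M (\<lambda>x. exp (- f x))" "integrable M (\<lambda>x. exp (- f x / 2))"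
      by (rule integrable_const_bound[where B = 1]; use nonneg[OF that] in simp)+
  qed
  define J where "J k = Inf (I ` C k)" for k
  have I_nonneg: "0 \<le> I f" for f
    unfolding I_def by simp
  have bdd: "bdd_below (I ` C k)" for k
    using I_nonneg by (auto intro!: bdd_belowI[where m = 0])
  have J_le: "J k \<le> I f" if "f \<in> C k" for f k
    unfolding J_def using that bdd by (auto intro!: cInf_lower)
  have C_sub: "C m \<subseteq> C k" if "k \<le> m" for k m
    using dec that by (auto simp: decseq_def)
  have "incseq J"
    unfolding J_def by (intro incseq_def[THEN iffD2] allI impI cInf_superset_mono image_mono C_sub bdd)
      (use ne in auto)
  moreover have "J k \<le> measure M (space M)" for k
  proof -
    obtain f where f: "f \<in> C k" using ne by blast
    have "I f \<le> (\<integral>x. 1 \<partial>M)"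
      unfolding I_def using nonneg[OF f] intI[OF f] by (intro integral_mono) auto
    then show ?thesis using J_le[OF f] by simp
  qed
  ultimately obtain L where "J \<longlonglongrightarrow> L"
    using incseq_convergent[of J] by blast
  then have Cauchy_J: "Cauchy J" by (rule LIMSEQ_imp_Cauchy)
  have "\<exists>f\<in>C k. I f < J k + 1 / real (Suc k)" for k
    using cInf_lessD[of "I ` C k" "J k + 1 / real (Suc k)"] ne[of k] unfolding J_def by auto
  then obtain f where f: "\<And>k. f k \<in> C k" and f_lt: "\<And>k. I (f k) < J k + 1 / real (Suc k)"
    by metis
  define h where "h k x = exp (- f k x / 2)" for k x
  have h_int: "integrable M (h k)" for k
    unfolding h_def using intI(2)[OF f] .
  have h_bound: "0 \<le> h k x" "h k x \<le> 1" for k x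
    unfolding h_def using nonneg[OF f] by auto
  have h_meas[measurable]: "h k \<in> borel_measurable M" for k
    using h_int by (rule borel_measurable_integrable)
  have sq_int: "integrable M (\<lambda>x. (h i x - h j x)\<^sup>2)" for i j
  proof (rule integrable_const_bound[where B = 1])
    have "\<bar>h i x - h j x\<bar>\<^sup>2 \<le> 1\<^sup>2" for x
      using h_bound[of i x] h_bound[of j x] by (intro power_mono) auto
    then show "AE x in M. norm ((h i x - h j x)\<^sup>2) \<le> 1" by simp
  qed measurable
  have sq_le: "(\<integral>x. (h i x - h j x)\<^sup>2 \<partial>M) \<le> \<bar>J j - J i\<bar> + 2 / real (Suc i)" if "i \<le> j" for i j
  proof -
    have fj: "f j \<in> C i" using f C_sub[OF that] by blast
    note m = mid[OF f[of i] fj]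
    have "(\<integral>x. (h i x - h j x)\<^sup>2 \<partial>M)
        = (\<integral>x. exp (- f i x) + exp (- f j x) - 2 * exp (- ((f i x + f j x) / 2)) \<partial>M)"
      unfolding h_def exp_midpoint_defect ..
    also have "\<dots> = I (f i) + I (f j) - 2 * I (\<lambda>x. (f i x + f j x) / 2)"
      unfolding I_def using intI(1)[OF f[of i]] intI(1)[OF fj] intI(1)[OF m] by simp
    also have "\<dots> \<le> (J i + 1 / real (Suc i)) + (J j + 1 / real (Suc j)) - 2 * J i"
      using f_lt[of i] f_lt[of j] J_le[OF m] by linarith
    also have "1 / real (Suc j) \<le> 1 / real (Suc i)"
      using that by (simp add: frac_le)
    finally show ?thesis by simp
  qed
  have small: "\<exists>N. \<forall>i\<ge>N. \<forall>j\<ge>N. (\<integral>x. norm (h i x - h j x) \<partial>M) < e" if "e > 0" for e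
  proof -
    define m where "m = measure M (space M)"
    define d where "d = e / (m + 1)"
    have m0: "m \<ge> 0" unfolding m_def by simp
    have d: "d > 0" unfolding d_def using that m0 by simp
    have dm: "d * m < e" unfolding d_def using that m0 by (simp add: field_simps)
    have de: "0 < d * e" using d that by simp
    obtain N1 where N1: "\<And>i j. i \<ge> N1 \<Longrightarrow> j \<ge> N1 \<Longrightarrow> \<bar>J j - J i\<bar> < d * e / 2"
      using Cauchy_J de unfolding Cauchy_def dist_real_def by (metis half_gt_zero)
    obtain N2 where N2: "1 / real (Suc N2) < d * e / 4"
      using de nat_approx_posE[of "d * e / 4"] by (metis divide_pos_pos zero_less_numeral)
    have le: "(\<integral>x. norm (h i x - h j x) \<partial>M) < e" if ij: "N1 + N2 \<le> i" "i \<le> j" for i j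
    proof -
      have "2 / real (Suc i) \<le> 2 / real (Suc N2)"
        using ij by (simp add: frac_le)
      then have sq: "(\<integral>x. (h i x - h j x)\<^sup>2 \<partial>M) < d * e"
        using sq_le[OF ij(2)] N1[of i j] ij N2 by simp
      \<comment> \<open>on a finite measure space small \<open>L\<^sup>2\<close> distance gives small \<open>L\<^sup>1\<close> distance, by \<open>2 d \<bar>y\<bar> \<le> y\<^sup>2 + d\<^sup>2\<close>\<close>
      have "norm (h i x - h j x) \<le> ((h i x - h j x)\<^sup>2 / d + d) / 2" for x
      proof -
        have "0 \<le> (\<bar>h i x - h j x\<bar> - d)\<^sup>2" by simp
        then have "2 * d * \<bar>h i x - h j x\<bar> \<le> (h i x - h j x)\<^sup>2 + d\<^sup>2"
          by (simp add: power2_diff algebra_simps)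
        then show ?thesis using d by (simp add: field_simps power2_eq_square)
      qed
      then have "(\<integral>x. norm (h i x - h j x) \<partial>M) \<le> (\<integral>x. ((h i x - h j x)\<^sup>2 / d + d) / 2 \<partial>M)"
        using sq_int h_int by (intro integral_mono) auto
      also have "\<dots> = ((\<integral>x. (h i x - h j x)\<^sup>2 \<partial>M) / d + d * m) / 2"
        using sq_int by (simp add: m_def)
      also have "\<dots> < (e + e) / 2"
        using sq dm d by (intro divide_strict_right_mono add_strict_mono) (auto simp: field_simps)
      finally show ?thesis by simp
    qed
    have "(\<integral>x. norm (h i x - h j x) \<partial>M) < e" if "N1 + N2 \<le> i" "N1 + N2 \<le> j" for i j
      using le[of i j] le[of j i] that by (cases "i \<le> j") (auto simp: abs_minus_commute)
    then show ?thesis by blast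
  qed
  obtain r where r: "strict_mono r" "AE x in M. Cauchy (\<lambda>i. h (r i) x)"
    using cauchy_L1_AE_cauchy_subseq[OF h_int small] .
  show thesis
  proof
    show "f (r k) \<in> C k" for k
      using f[of "r k"] C_sub[of k "r k"] seq_suble[OF r(1), of k] by blast
    show "AE x in M. convergent (\<lambda>k. exp (- f (r k) x / 2))"
      using r(2) by eventually_elim (simp add: h_def Cauchy_convergent_iff)
  qed
qed

text \<open>
  A bound in \<open>L\<^sup>1\<close> excludes, by Fatou's lemma, that the sequence tends to infinity on a set of positive
  measure, so convergence passes from \<open>exp (- f k / 2)\<close> to \<open>f k\<close>.
\<close>

lemma (in finite_measure) nested_midpoint_convex_AE_limit:
  fixes C :: "nat \<Rightarrow> ('a \<Rightarrow> real) set" and b :: ennreal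
  assumes dec: "decseq C" and ne: "\<And>k. C k \<noteq> {}"
    and meas: "\<And>k f. f \<in> C k \<Longrightarrow> f \<in> borel_measurable M"
    and nonneg: "\<And>k f x. f \<in> C k \<Longrightarrow> 0 \<le> f x"
    and mid: "\<And>k f g. f \<in> C k \<Longrightarrow> g \<in> C k \<Longrightarrow> (\<lambda>x. (f x + g x) / 2) \<in> C k"
    and bound: "\<And>k f. f \<in> C k \<Longrightarrow> (\<integral>\<^sup>+x. ennreal (f x) \<partial>M) \<le> b" and "b < \<infinity>"
  obtains f F where "\<And>k. f k \<in> C k" and "F \<in> borel_measurable M" and "\<And>x. 0 \<le> F x"
    and "AE x in M. (\<lambda>k. f k x) \<longlonglongrightarrow> F x"
proof -
  have "\<exists>f. (\<forall>k. f k \<in> C k) \<and> (AE x in M. convergent (\<lambda>k. exp (- f k x / 2)))"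
    by (rule nested_midpoint_convex_AE_convergent[where C = C])
       (rule dec ne | (rule meas nonneg mid; assumption) | blast)+
  then obtain f where f: "\<And>k. f k \<in> C k" and conv: "AE x in M. convergent (\<lambda>k. exp (- f k x / 2))"
    by blast
  note meas[OF f, measurable]
  have "(\<integral>\<^sup>+x. liminf (\<lambda>k. ennreal (f k x)) \<partial>M) \<le> liminf (\<lambda>k. \<integral>\<^sup>+x. ennreal (f k x) \<partial>M)"
    by (rule nn_integral_liminf) measurable
  also have "\<dots> \<le> b"
    by (rule Liminf_le) (use bound[OF f] in auto)
  finally have "(\<integral>\<^sup>+x. liminf (\<lambda>k. ennreal (f k x)) \<partial>M) \<noteq> \<infinity>"
    using \<open>b < \<infinity>\<close> by auto
  then have fin: "AE x in M. liminf (\<lambda>k. ennreal (f k x)) \<noteq> \<infinity>"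
    by (intro nn_integral_noteq_infinite) measurable
  have lim: "AE x in M. (\<lambda>k. f k x) \<longlonglongrightarrow> max 0 (lim (\<lambda>k. f k x))"
    using conv fin
  proof eventually_elim
    case (elim x)
    then obtain l where l: "(\<lambda>k. exp (- f k x / 2)) \<longlonglongrightarrow> l"
      by (auto simp: convergent_def)
    have "l \<ge> 0" by (rule LIMSEQ_le_const[OF l]) auto
    moreover have "l \<noteq> 0"
    proof
      assume "l = 0"
      then have "filterlim (\<lambda>k. exp (- f k x / 2)) (at_right 0) sequentially"
        using l by (auto simp: filterlim_at)
      then have "filterlim (\<lambda>k. ln (exp (- f k x / 2))) at_bot sequentially"
        by (rule filterlim_compose[OF ln_at_0])
      then have "filterlim (\<lambda>k. 2 * (f k x / 2)) at_top sequentially"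
        by (intro filterlim_tendsto_pos_mult_at_top[OF tendsto_const])
           (auto simp: filterlim_uminus_at_bot)
      then have top: "filterlim (\<lambda>k. f k x) at_top sequentially" by simp
      have "eventually (\<lambda>k. ennreal B \<le> ennreal (f k x)) sequentially" for B
        using filterlim_at_top[THEN iffD1, rule_format, OF top, of B]
        by eventually_elim (rule ennreal_leI)
      then have "ennreal B \<le> liminf (\<lambda>k. ennreal (f k x))" for B
        by (rule Liminf_bounded)
      then show False
      proof (cases "liminf (\<lambda>k. ennreal (f k x))")
        case (real r)
        then show False
          using \<open>\<And>B. ennreal B \<le> liminf (\<lambda>k. ennreal (f k x))\<close>[of "r + 1"] by simp
      qed (use elim in simp)
    qed
    ultimately have "(\<lambda>k. - 2 * ln (exp (- f k x / 2))) \<longlonglongrightarrow> - 2 * ln l"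
      by (intro tendsto_intros l) auto
    then have *: "(\<lambda>k. f k x) \<longlonglongrightarrow> - 2 * ln l" by simp
    moreover have "0 \<le> - 2 * ln l"
      by (rule LIMSEQ_le_const[OF *]) (use nonneg[OF f] in auto)
    ultimately show ?case by (simp add: limI)
  qed
  show thesis
    by (rule that[of f "\<lambda>x. max 0 (lim (\<lambda>k. f k x))"]) (use f lim in auto)
qed


section \<open>Energies with superlinear growth\<close>

text \<open>
  This is the criterion of de la Vallee-Poussin in the form needed here. The part of \<open>f k\<close> above a high
  level \<open>T\<close> has mass at most \<open>1 / N\<close> times the bound on \<open>G\<close>, while dominated convergence applies to
  the truncation \<open>min (f k) T\<close>. Together with Fatou's lemma no mass is lost in the limit.
\<close>

lemma (in finite_measure) superlinear_bound_keeps_mass: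
  fixes f :: "nat \<Rightarrow> 'a \<Rightarrow> real" and G :: "nat \<Rightarrow> 'a \<Rightarrow> ennreal"
  assumes [measurable]: "\<And>k. f k \<in> borel_measurable M" "F \<in> borel_measurable M" "\<And>k. G k \<in> borel_measurable M"
    and nonneg: "\<And>k x. 0 \<le> f k x"
    and lim: "AE x in M. (\<lambda>k. f k x) \<longlonglongrightarrow> F x"
    and bound: "\<And>k. (\<integral>\<^sup>+x. G k x \<partial>M) \<le> b" and "b < \<infinity>"
    and super: "\<And>N. \<exists>T. \<forall>k. \<forall>x\<in>space M. T \<le> f k x \<longrightarrow> ennreal (N * f k x) \<le> G k x"
    and mass: "\<And>k. m \<le> (\<integral>\<^sup>+x. ennreal (f k x) \<partial>M)"
  shows "m \<le> (\<integral>\<^sup>+x. ennreal (F x) \<partial>M)"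
proof (rule ennreal_le_epsilon)
  fix e :: real assume "0 < e"
  obtain b' where b': "b = ennreal b'" "0 \<le> b'"
    using \<open>b < \<infinity>\<close> by (cases b) auto
  define N where "N = (b' + 1) / e"
  have N: "0 < N" "b' / N \<le> e"
    using b' \<open>0 < e\<close> by (auto simp: N_def field_simps)
  obtain T where T: "\<And>k x. x \<in> space M \<Longrightarrow> T \<le> f k x \<Longrightarrow> ennreal (N * f k x) \<le> G k x"
    using super by metis
  define T' where "T' = max 0 T"
  have split: "ennreal (f k x) \<le> ennreal (min (f k x) T') + ennreal (1 / N) * G k x" if "x \<in> space M" for k x
  proof (cases "T' \<le> f k x")
    case True
    then have "ennreal (1 / N) * ennreal (N * f k x) \<le> ennreal (1 / N) * G k x"
      using T[OF that] by (intro mult_left_mono) (auto simp: T'_def)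
    moreover have "ennreal (1 / N) * ennreal (N * f k x) = ennreal (f k x)"
      using N nonneg[of k x] by (simp flip: ennreal_mult')
    ultimately show ?thesis by (simp add: add_increasing)
  next
    case False
    then show ?thesis by (simp add: min_def add_increasing2)
  qed
  have le: "m \<le> (\<integral>\<^sup>+x. ennreal (min (f k x) T') \<partial>M) + ennreal e" for k
  proof -
    have "m \<le> (\<integral>\<^sup>+x. ennreal (min (f k x) T') + ennreal (1 / N) * G k x \<partial>M)"
      using mass[of k] nn_integral_mono[OF split] by (rule order_trans)
    also have "\<dots> = (\<integral>\<^sup>+x. ennreal (min (f k x) T') \<partial>M) + ennreal (1 / N) * (\<integral>\<^sup>+x. G k x \<partial>M)"
      by (subst nn_integral_add) (auto simp: nn_integral_cmult)
    also have "ennreal (1 / N) * (\<integral>\<^sup>+x. G k x \<partial>M) \<le> ennreal (1 / N) * b"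
      by (intro mult_left_mono bound) simp
    also have "ennreal (1 / N) * b \<le> ennreal e"
      using b' N by (simp flip: ennreal_mult add: ennreal_leI)
    finally show ?thesis by (simp add: add_left_mono)
  qed
  have "(\<lambda>k. \<integral>\<^sup>+x. ennreal (min (f k x) T') \<partial>M) \<longlonglongrightarrow> (\<integral>\<^sup>+x. ennreal (min (F x) T') \<partial>M)"
  proof (rule nn_integral_dominated_convergence)
    show "(\<integral>\<^sup>+x. ennreal T' \<partial>M) < \<infinity>"
      by (simp add: emeasure_eq_measure ennreal_mult_less_top)
    show "AE x in M. (\<lambda>k. ennreal (min (f k x) T')) \<longlonglongrightarrow> ennreal (min (F x) T')"
      using lim by eventually_elim (intro tendsto_intros)
  qed (auto intro!: ennreal_leI)
  then have "m \<le> (\<integral>\<^sup>+x. ennreal (min (F x) T') \<partial>M) + ennreal e"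
    by (intro LIMSEQ_le_const[OF tendsto_add[OF _ tendsto_const]]) (use le in auto)
  also have "\<dots> \<le> (\<integral>\<^sup>+x. ennreal (F x) \<partial>M) + ennreal e"
    by (intro add_right_mono nn_integral_mono ennreal_leI) simp
  finally show "m \<le> (\<integral>\<^sup>+x. ennreal (F x) \<partial>M) + ennreal e" .
qed

text \<open>
  The linear constraints of a transport problem in the form in which they are needed for limits: a
  family of test sets and the mass of each of them.
\<close>

definition densities_with_masses :: "'a measure \<Rightarrow> 'a set set \<Rightarrow> ('a set \<Rightarrow> ennreal) \<Rightarrow> ('a \<Rightarrow> real) set" where
  "densities_with_masses M \<D> m =
     {f \<in> borel_measurable M. (\<forall>x. 0 \<le> f x) \<and> (\<forall>B\<in>\<D>. (\<integral>\<^sup>+x\<in>B. ennreal (f x) \<partial>M) = m B)}"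

lemma densities_with_masses_midpoint:
  assumes f: "f \<in> densities_with_masses M \<D> m" and g: "g \<in> densities_with_masses M \<D> m"
    and D: "\<D> \<subseteq> sets M"
  shows "(\<lambda>x. (f x + g x) / 2) \<in> densities_with_masses M \<D> m"
proof -
  have [measurable]: "f \<in> borel_measurable M" "g \<in> borel_measurable M"
    using f g by (auto simp: densities_with_masses_def)
  have nonneg: "0 \<le> f x" "0 \<le> g x" for x
    using f g by (auto simp: densities_with_masses_def)
  have "(\<integral>\<^sup>+x\<in>B. ennreal ((f x + g x) / 2) \<partial>M) = m B" if B: "B \<in> \<D>" for B
  proof -
    have [measurable]: "B \<in> sets M" using B D by blast
    have "ennreal ((f x + g x) / 2) * indicator B x
        = ennreal (1 / 2) * (ennreal (f x) * indicator B x + ennreal (g x) * indicator B x)" for x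
    proof -
      have "ennreal ((f x + g x) / 2) = ennreal (1 / 2) * (ennreal (f x) + ennreal (g x))"
        unfolding ennreal_plus[OF nonneg, symmetric]
        using nonneg[of x] by (subst ennreal_mult[symmetric]) auto
      then show ?thesis by (simp only: distrib_left distrib_right mult.assoc)
    qed
    then have "(\<integral>\<^sup>+x\<in>B. ennreal ((f x + g x) / 2) \<partial>M)
        = ennreal (1 / 2) * ((\<integral>\<^sup>+x\<in>B. ennreal (f x) \<partial>M) + (\<integral>\<^sup>+x\<in>B. ennreal (g x) \<partial>M))"
      by (simp add: nn_integral_cmult nn_integral_add)
    also have "\<dots> = ennreal (1 / 2) * (m B + m B)"
      using f g B by (simp add: densities_with_masses_def)
    also have "\<dots> = m B"
    proof -
      have "ennreal (1 / 2) * ennreal 2 = 1"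
        by (subst ennreal_mult[symmetric]) auto
      then show ?thesis by (metis ennreal_numeral mult.assoc mult_1 mult_2)
    qed
    finally show ?thesis .
  qed
  then show ?thesis
    using nonneg by (auto simp: densities_with_masses_def)
qed

text \<open>
  By Fatou's lemma the limit has at most the prescribed mass on each test set. A deficit on \<open>B\<close> could
  not be made up on its complement, which is a test set too, and so would contradict the total mass.
\<close>

lemma densities_with_masses_AE_limit:
  assumes f: "\<And>k. f k \<in> densities_with_masses M \<D> m"
    and [measurable]: "F \<in> borel_measurable M" and F0: "\<And>x. 0 \<le> F x"
    and lim: "AE x in M. (\<lambda>k. f k x) \<longlonglongrightarrow> F x"
    and D: "\<D> \<subseteq> sets M" "space M \<in> \<D>" "\<And>B. B \<in> \<D> \<Longrightarrow> space M - B \<in> \<D>"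
    and fin: "m (space M) < \<infinity>"
    and mass: "m (space M) \<le> (\<integral>\<^sup>+x. ennreal (F x) \<partial>M)"
  shows "F \<in> densities_with_masses M \<D> m"
proof -
  have [measurable]: "f k \<in> borel_measurable M" for k
    using f by (auto simp: densities_with_masses_def)
  have fm: "(\<integral>\<^sup>+x\<in>B. ennreal (f k x) \<partial>M) = m B" if "B \<in> \<D>" for k B
    using f that by (auto simp: densities_with_masses_def)
  have le: "(\<integral>\<^sup>+x\<in>B. ennreal (F x) \<partial>M) \<le> m B" if B: "B \<in> \<D>" for B
  proof -
    have [measurable]: "B \<in> sets M" using B D by blast
    have "AE x in M. ennreal (F x) * indicator B x = liminf (\<lambda>k. ennreal (f k x) * indicator B x)"
      using lim
    proof eventually_elim
      case (elim x)
      have "(\<lambda>k. ennreal (f k x) * indicator B x) \<longlonglongrightarrow> ennreal (F x) * indicator B x"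
        using elim by (cases "x \<in> B") auto
      then show ?case by (intro lim_imp_Liminf[symmetric]) auto
    qed
    then have "(\<integral>\<^sup>+x\<in>B. ennreal (F x) \<partial>M) = (\<integral>\<^sup>+x. liminf (\<lambda>k. ennreal (f k x) * indicator B x) \<partial>M)"
      by (rule nn_integral_cong_AE)
    also have "\<dots> \<le> liminf (\<lambda>k. \<integral>\<^sup>+x\<in>B. ennreal (f k x) \<partial>M)"
      by (rule nn_integral_liminf) measurable
    also have "\<dots> = m B" by (simp add: fm[OF B] Liminf_const)
    finally show ?thesis .
  qed
  have split: "(\<integral>\<^sup>+x. ennreal (h x) \<partial>M) = (\<integral>\<^sup>+x\<in>B. ennreal (h x) \<partial>M) + (\<integral>\<^sup>+x\<in>space M - B. ennreal (h x) \<partial>M)"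
    if "B \<in> \<D>" and [measurable]: "h \<in> borel_measurable M" for B h
  proof -
    have [measurable]: "B \<in> sets M" using that D by blast
    show ?thesis
      by (subst nn_integral_add[symmetric]) (auto intro!: nn_integral_cong simp: indicator_def)
  qed
  have "(\<integral>\<^sup>+x\<in>B. ennreal (F x) \<partial>M) = m B" if B: "B \<in> \<D>" for B
  proof (rule ccontr)
    assume "\<not> ?thesis"
    then have lt: "(\<integral>\<^sup>+x\<in>B. ennreal (F x) \<partial>M) < m B"
      using le[OF B] by simp
    have "(\<integral>\<^sup>+x\<in>space M. ennreal (f 0 x) \<partial>M) = (\<integral>\<^sup>+x. ennreal (f 0 x) \<partial>M)"
      by (rule nn_set_integral_space)
    then have add: "m (space M) = m B + m (space M - B)"
      using split[OF B, of "f 0"] fm[OF B, of 0] fm[OF D(3)[OF B], of 0] fm[OF D(2), of 0]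
      by simp
    have "(\<integral>\<^sup>+x. ennreal (F x) \<partial>M) \<le> (\<integral>\<^sup>+x\<in>B. ennreal (F x) \<partial>M) + m (space M - B)"
      using le[OF D(3)[OF B]] by (simp add: split[OF B] add_left_mono)
    also have "\<dots> < m B + m (space M - B)"
      using lt fin add by (simp add: ennreal_add_less_top less_top add.commute ennreal_add_left_cancel_less)
    finally show False using mass add by simp
  qed
  then show ?thesis using F0 by (auto simp: densities_with_masses_def)
qed

locale superlinear_energy = finite_measure M for M :: "'a measure" +
  fixes g :: "'a \<Rightarrow> real \<Rightarrow> ennreal"
  assumes g_measurable: "f \<in> borel_measurable M \<Longrightarrow> (\<And>x. 0 \<le> f x) \<Longrightarrow> (\<lambda>x. g x (f x)) \<in> borel_measurable M"
    and g_midpoint: "x \<in> space M \<Longrightarrow> 0 \<le> s \<Longrightarrow> 0 \<le> t \<Longrightarrow> 2 * g x ((s + t) / 2) \<le> g x s + g x t"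
    and g_lsc: "x \<in> space M \<Longrightarrow> (\<And>k. 0 \<le> u k) \<Longrightarrow> u \<longlonglongrightarrow> t \<Longrightarrow> g x t \<le> liminf (\<lambda>k. g x (u k))"
    and g_superlinear: "\<exists>T. \<forall>x\<in>space M. \<forall>t\<ge>T. ennreal (N * t) \<le> g x t"
begin

definition energy :: "('a \<Rightarrow> real) \<Rightarrow> ennreal" where
  "energy f = (\<integral>\<^sup>+x. g x (f x) \<partial>M)"

lemma energy_midpoint:
  assumes f: "f \<in> borel_measurable M" "\<And>x. 0 \<le> f x" and h: "h \<in> borel_measurable M" "\<And>x. 0 \<le> h x"
  shows "2 * energy (\<lambda>x. (f x + h x) / 2) \<le> energy f + energy h"
proof -
  have [measurable]: "(\<lambda>x. g x (f x)) \<in> borel_measurable M" "(\<lambda>x. g x (h x)) \<in> borel_measurable M"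
    "(\<lambda>x. g x ((f x + h x) / 2)) \<in> borel_measurable M"
    using f h by (auto intro!: g_measurable)
  have "2 * energy (\<lambda>x. (f x + h x) / 2) = (\<integral>\<^sup>+x. 2 * g x ((f x + h x) / 2) \<partial>M)"
    unfolding energy_def by (simp add: nn_integral_cmult)
  also have "\<dots> \<le> (\<integral>\<^sup>+x. g x (f x) + g x (h x) \<partial>M)"
    by (intro nn_integral_mono g_midpoint f h)
  finally show ?thesis unfolding energy_def by (simp add: nn_integral_add)
qed

lemma energy_lsc:
  assumes f: "\<And>k. f k \<in> borel_measurable M" "\<And>k x. 0 \<le> f k x"
    and lim: "AE x in M. (\<lambda>k. f k x) \<longlonglongrightarrow> F x"
  shows "energy F \<le> liminf (\<lambda>k. energy (f k))"
proof -
  have "energy F \<le> (\<integral>\<^sup>+x. liminf (\<lambda>k. g x (f k x)) \<partial>M)"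
    unfolding energy_def using lim
    by (intro nn_integral_mono_AE) (use f in \<open>auto intro!: g_lsc\<close>)
  also have "\<dots> \<le> liminf (\<lambda>k. energy (f k))"
    unfolding energy_def by (intro nn_integral_liminf g_measurable f)
  finally show ?thesis .
qed

text \<open>
  The families \<open>C k\<close> of \<open>1 / Suc k\<close>-minimizers are convex and decreasing, so that an almost everywhere
  convergent minimizing sequence can be selected from them. Its limit keeps the total mass because the
  energies are bounded by \<open>e + 1\<close>, where \<open>e\<close> is the infimum.
\<close>

theorem energy_minimizer_exists:
  assumes D: "\<D> \<subseteq> sets M" "space M \<in> \<D>" "\<And>B. B \<in> \<D> \<Longrightarrow> space M - B \<in> \<D>"
    and fin: "m (space M) < \<infinity>"
    and f0: "f0 \<in> densities_with_masses M \<D> m" "energy f0 < \<infinity>"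
  obtains F where "F \<in> densities_with_masses M \<D> m"
    and "\<And>f. f \<in> densities_with_masses M \<D> m \<Longrightarrow> energy F \<le> energy f"
proof -
  define S where "S = densities_with_masses M \<D> m"
  have S: "f \<in> borel_measurable M" "0 \<le> f x" if "f \<in> S" for f x
    using that by (auto simp: S_def densities_with_masses_def)
  have S_mass: "(\<integral>\<^sup>+x. ennreal (f x) \<partial>M) = m (space M)" if "f \<in> S" for f
    using that D(2) nn_set_integral_space[of M "\<lambda>x. ennreal (f x)"]
    by (auto simp: S_def densities_with_masses_def)
  define e where "e = (INF f\<in>S. energy f)"
  have e_le: "e \<le> energy f" if "f \<in> S" for f
    unfolding e_def using that by (rule INF_lower)
  have e_fin: "e < \<infinity>"
    using e_le[of f0] f0 by (auto simp: S_def)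
  define C where "C k = {f \<in> S. energy f \<le> e + ennreal (1 / real (Suc k))}" for k
  have "decseq C"
  proof (rule decseq_SucI)
    fix k
    have "ennreal (1 / real (Suc (Suc k))) \<le> ennreal (1 / real (Suc k))"
      by (intro ennreal_leI) (simp add: frac_le)
    then show "C (Suc k) \<subseteq> C k"
      unfolding C_def by (auto intro: order_trans add_left_mono)
  qed
  moreover have "C k \<noteq> {}" for k
  proof -
    have "e < e + ennreal (1 / real (Suc k))"
      using e_fin by (cases e) (auto simp flip: ennreal_plus simp: ennreal_less_iff)
    then show ?thesis
      unfolding e_def by (subst (asm) INF_less_iff) (auto simp: C_def e_def intro: less_imp_le)
  qed
  moreover have "(\<lambda>x. (f x + h x) / 2) \<in> C k" if fh: "f \<in> C k" "h \<in> C k" for f h k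
  proof -
    have fS: "f \<in> S" "h \<in> S" using fh by (auto simp: C_def)
    have "2 * energy (\<lambda>x. (f x + h x) / 2) \<le> energy f + energy h"
      by (intro energy_midpoint S fS)
    also have "\<dots> \<le> (e + ennreal (1 / real (Suc k))) + (e + ennreal (1 / real (Suc k)))"
      using fh by (intro add_mono) (auto simp: C_def)
    also have "\<dots> = 2 * (e + ennreal (1 / real (Suc k)))" by (simp only: mult_2)
    finally have "energy (\<lambda>x. (f x + h x) / 2) \<le> e + ennreal (1 / real (Suc k))"
      by (subst (asm) ennreal_mult_le_mult_iff) auto
    then show ?thesis
      using densities_with_masses_midpoint[OF fS[unfolded S_def] D(1)] by (simp add: C_def S_def)
  qed
  ultimately obtain f F where f: "\<And>k. f k \<in> C k" and F: "F \<in> borel_measurable M" "\<And>x. 0 \<le> F x"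
    and lim: "AE x in M. (\<lambda>k. f k x) \<longlonglongrightarrow> F x"
    using S S_mass fin
    by (elim nested_midpoint_convex_AE_limit[where C = C and b = "m (space M)"]) (auto simp: C_def)
  have fS: "f k \<in> S" for k using f by (auto simp: C_def)
  have f_le: "energy (f k) \<le> e + ennreal (1 / real (Suc k))" for k using f by (auto simp: C_def)
  have "m (space M) \<le> (\<integral>\<^sup>+x. ennreal (F x) \<partial>M)"
  proof (rule superlinear_bound_keeps_mass[where f = f and G = "\<lambda>k x. g x (f k x)" and b = "e + 1"])
    show "(\<integral>\<^sup>+x. g x (f k x) \<partial>M) \<le> e + 1" for k
    proof -
      have "ennreal (1 / real (Suc k)) \<le> 1" by (simp add: ennreal_le_1)
      then show ?thesis
        using f_le[of k] unfolding energy_def by (meson add_left_mono order_trans)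
    qed
    show "\<exists>T. \<forall>k. \<forall>x\<in>space M. T \<le> f k x \<longrightarrow> ennreal (N * f k x) \<le> g x (f k x)" for N
      using g_superlinear[of N] by blast
  qed (use S[OF fS] F lim e_fin S_mass[OF fS] in \<open>auto intro!: g_measurable simp: less_top\<close>)
  note mass = this
  have FS: "F \<in> S"
    unfolding S_def
    by (rule densities_with_masses_AE_limit[where f = f]; (fact fS[unfolded S_def] F lim D(1,2) fin mass | erule D(3)))
  have "energy F \<le> liminf (\<lambda>k. energy (f k))"
    by (rule energy_lsc[OF S(1)[OF fS] S(2)[OF fS] lim])
  also have "\<dots> \<le> liminf (\<lambda>k. e + ennreal (1 / real (Suc k)))"
    by (intro Liminf_mono always_eventually allI f_le)
  also have "\<dots> = e"
  proof (rule lim_imp_Liminf)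
    have "(\<lambda>k. e + ennreal (1 / real (Suc k))) \<longlonglongrightarrow> e + ennreal 0"
      using LIMSEQ_inverse_real_of_nat by (intro tendsto_intros) (simp add: inverse_eq_divide)
    then show "(\<lambda>k. e + ennreal (1 / real (Suc k))) \<longlonglongrightarrow> e" by simp
  qed simp
  finally have "energy F \<le> e" .
  show thesis
    by (rule that[of F]) (use FS \<open>energy F \<le> e\<close> e_le in \<open>auto simp: S_def intro: order_trans\<close>)
qed

text \<open>If two minimizers differed on a set of positive measure, their midpoint would have smaller energy.\<close>

theorem energy_minimizer_unique:
  assumes D: "\<D> \<subseteq> sets M"
    and strict: "\<And>x s t. x \<in> space M \<Longrightarrow> 0 \<le> s \<Longrightarrow> 0 \<le> t \<Longrightarrow> s \<noteq> t \<Longrightarrow> g x s < \<infinity> \<Longrightarrow> g x t < \<infinity>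
      \<Longrightarrow> 2 * g x ((s + t) / 2) < g x s + g x t"
    and f: "f \<in> densities_with_masses M \<D> m" "\<And>u. u \<in> densities_with_masses M \<D> m \<Longrightarrow> energy f \<le> energy u"
    and h: "h \<in> densities_with_masses M \<D> m" "\<And>u. u \<in> densities_with_masses M \<D> m \<Longrightarrow> energy h \<le> energy u"
    and fin: "energy f < \<infinity>"
  shows "AE x in M. f x = h x"
proof (rule ccontr)
  assume neq: "\<not> ?thesis"
  have meas: "f \<in> borel_measurable M" "h \<in> borel_measurable M" and nonneg: "0 \<le> f x" "0 \<le> h x" for x
    using f h by (auto simp: densities_with_masses_def)
  have [measurable]: "(\<lambda>x. g x (f x)) \<in> borel_measurable M" "(\<lambda>x. g x (h x)) \<in> borel_measurable M"
    "(\<lambda>x. g x ((f x + h x) / 2)) \<in> borel_measurable M"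
    using meas nonneg by (auto intro!: g_measurable)
  have eq: "energy h = energy f"
    using f h by (auto intro: antisym)
  have "AE x in M. g x (f x) \<noteq> \<infinity>" "AE x in M. g x (h x) \<noteq> \<infinity>"
    using fin eq by (intro nn_integral_noteq_infinite; simp add: energy_def)+
  then have finite: "AE x in M. g x (f x) < \<infinity> \<and> g x (h x) < \<infinity>"
    by eventually_elim (auto simp: less_top)
  have "2 * energy (\<lambda>x. (f x + h x) / 2) = (\<integral>\<^sup>+x. 2 * g x ((f x + h x) / 2) \<partial>M)"
    unfolding energy_def by (simp add: nn_integral_cmult)
  also have "\<dots> < (\<integral>\<^sup>+x. g x (f x) + g x (h x) \<partial>M)"
  proof (rule nn_integral_less)
    have "2 * energy (\<lambda>x. (f x + h x) / 2) \<le> energy f + energy h"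
      by (rule energy_midpoint[OF meas(1) nonneg(1) meas(2) nonneg(2)])
    then have "2 * energy (\<lambda>x. (f x + h x) / 2) < \<infinity>"
      using fin eq by (auto simp: less_top[symmetric] top_unique)
    then show "(\<integral>\<^sup>+x. 2 * g x ((f x + h x) / 2) \<partial>M) \<noteq> \<infinity>"
      unfolding energy_def by (simp add: nn_integral_cmult)
    show "AE x in M. 2 * g x ((f x + h x) / 2) \<le> g x (f x) + g x (h x)"
      by (intro AE_I2 g_midpoint nonneg)
    show "\<not> (AE x in M. g x (f x) + g x (h x) \<le> 2 * g x ((f x + h x) / 2))"
    proof
      assume "AE x in M. g x (f x) + g x (h x) \<le> 2 * g x ((f x + h x) / 2)"
      then have "AE x in M. f x = h x"
        using finite AE_space
      proof eventually_elim
        case (elim x)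
        then show ?case
          using strict[of x "f x" "h x"] nonneg[of x] by (meson leD)
      qed
      with neq show False by simp
    qed
  qed measurable
  also have "\<dots> = 2 * energy f"
    using eq by (simp add: nn_integral_add energy_def mult_2)
  finally have "energy (\<lambda>x. (f x + h x) / 2) < energy f"
    by (metis linorder_not_le mult_left_mono zero_le)
  then show False
    using f(2)[OF densities_with_masses_midpoint[OF f(1) h(1) D]] by simp
qed

end

section \<open>Quasi-Young functions\<close>

lemma quasi_young_zero_le:
  assumes "quasi_young \<Phi>"
  shows "\<Phi> 0 \<le> 0"
proof -
  obtain \<phi> :: "real \<Rightarrow> ennreal" where "\<forall>t\<ge>0. max (\<Phi> t) 0 = enn2ereal (\<integral>\<^sup>+s\<in>{0..t}. \<phi> s \<partial>lborel)"
    using assms by (auto simp: quasi_young_def young_def)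
  then have "max (\<Phi> 0) 0 = enn2ereal (\<integral>\<^sup>+s\<in>{0..0}. \<phi> s \<partial>lborel)" by blast
  also have "(\<integral>\<^sup>+s\<in>{0..0}. \<phi> s \<partial>lborel) = 0"
  proof -
    have "AE s in lborel. s \<noteq> (0::real)" by (rule AE_lborel_singleton)
    then have "AE s in lborel. \<phi> s * indicator {0..0} s = 0"
      by eventually_elim auto
    then have "(\<integral>\<^sup>+s\<in>{0..0}. \<phi> s \<partial>lborel) = (\<integral>\<^sup>+s. 0 \<partial>(lborel::real measure))"
      by (rule nn_integral_cong_AE)
    then show ?thesis by simp
  qed
  finally have "max (\<Phi> 0) 0 = 0" by (simp add: zero_ennreal.rep_eq)
  then show ?thesis by (metis max.cobounded1)
qed

lemma quasi_young_convex:
  assumes "quasi_young \<Phi>" "0 \<le> s" "0 \<le> t" "0 \<le> u" "u \<le> 1"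
  shows "\<Phi> ((1 - u) * s + u * t) \<le> ereal (1 - u) * \<Phi> s + ereal u * \<Phi> t"
  using assms by (simp add: quasi_young_def)

text \<open>Convexity between \<open>0\<close> and \<open>t\<close>, since \<open>\<Phi> 0 \<le> 0\<close>.\<close>

lemma quasi_young_shrink:
  assumes "quasi_young \<Phi>" "0 \<le> t" "0 \<le> u" "u \<le> 1"
  shows "\<Phi> (u * t) \<le> ereal u * \<Phi> t"
proof -
  have "\<Phi> (u * t) \<le> ereal (1 - u) * \<Phi> 0 + ereal u * \<Phi> t"
    using quasi_young_convex[OF assms(1) order_refl assms(2-4)] by simp
  also have "\<dots> \<le> 0 + ereal u * \<Phi> t"
    using quasi_young_zero_le[OF assms(1)] assms
    by (intro add_right_mono) (auto simp: ereal_mult_le_0_iff)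
  finally show ?thesis by simp
qed

lemma quasi_young_lsc:
  fixes u :: "nat \<Rightarrow> real"
  assumes \<Phi>: "quasi_young \<Phi>" and u: "\<And>k. 0 \<le> u k" "u \<longlonglongrightarrow> t"
  shows "\<Phi> t \<le> liminf (\<lambda>k. \<Phi> (u k))"
proof -
  have "0 \<le> t" by (rule LIMSEQ_le_const[OF u(2)]) (use u in auto)
  then have *: "\<Phi> t \<le> Liminf (at t within {0..}) \<Phi>"
    using \<Phi> by (auto simp: quasi_young_def lsc_on_def)
  show ?thesis
    unfolding le_Liminf_iff
  proof (intro allI impI)
    fix y assume "y < \<Phi> t"
    then have "eventually (\<lambda>x. y < \<Phi> x) (at t within {0..})"
      using * by (auto simp: le_Liminf_iff)
    then have "eventually (\<lambda>x. x \<in> {0..} \<longrightarrow> y < \<Phi> x) (nhds t)"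
      unfolding eventually_at_filter by eventually_elim (use \<open>y < \<Phi> t\<close> in auto)
    then have "eventually (\<lambda>k. u k \<in> {0..} \<longrightarrow> y < \<Phi> (u k)) sequentially"
      using u(2) by (rule eventually_compose_filterlim)
    then show "eventually (\<lambda>k. y < \<Phi> (u k)) sequentially"
      using u(1) by simp
  qed
qed

text \<open>
  Lower semicontinuity makes the sublevel sets closed. As \<open>\<Phi>\<close> is only controlled on \<open>{0..}\<close>, the
  function \<open>\<lambda>t. \<Phi> (max 0 t)\<close> takes its place.
\<close>

lemma quasi_young_measurable:
  assumes \<Phi>: "quasi_young \<Phi>" and f: "f \<in> borel_measurable M" "\<And>x. 0 \<le> f x"
  shows "(\<lambda>x. \<Phi> (f x)) \<in> borel_measurable M"
proof -
  have "(\<lambda>t. \<Phi> (max 0 t)) \<in> borel_measurable borel"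
    unfolding borel_measurable_iff_Iic_ereal
  proof
    fix a :: ereal
    have "closed {t. \<Phi> (max 0 t) \<le> a}"
      unfolding closed_sequential_limits
    proof (intro allI impI, elim conjE)
      fix u t assume u: "\<forall>n. u n \<in> {t. \<Phi> (max 0 t) \<le> a}" and "u \<longlonglongrightarrow> t"
      then have "(\<lambda>n. max 0 (u n)) \<longlonglongrightarrow> max 0 t" by (intro tendsto_intros)
      then have "\<Phi> (max 0 t) \<le> liminf (\<lambda>n. \<Phi> (max 0 (u n)))"
        by (intro quasi_young_lsc \<Phi>) auto
      also have "\<dots> \<le> a"
        using u by (intro Liminf_le) auto
      finally show "t \<in> {t. \<Phi> (max 0 t) \<le> a}" by simp
    qed
    then show "(\<lambda>t. \<Phi> (max 0 t)) -` {..a} \<inter> space borel \<in> sets borel"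
      by (simp add: vimage_def)
  qed
  then have "(\<lambda>x. \<Phi> (max 0 (f x))) \<in> borel_measurable M"
    using f(1) by (rule measurable_compose[rotated])
  then show ?thesis using f(2) by (simp add: max_absorb2)
qed

lemma superlinear_eventually_ge:
  fixes \<Phi> :: "real \<Rightarrow> ereal"
  assumes "((\<lambda>t. \<Phi> t / ereal t) \<longlongrightarrow> \<infinity>) at_top"
  obtains T where "0 < T" "\<And>t. T \<le> t \<Longrightarrow> ereal (N * t) \<le> \<Phi> t"
proof -
  have "eventually (\<lambda>t. ereal N < \<Phi> t / ereal t) at_top"
    using assms by (auto intro: order_tendstoD)
  then have "eventually (\<lambda>t. ereal (N * t) \<le> \<Phi> t) at_top"
    using eventually_gt_at_top[of 0]
  proof eventually_elim
    case (elim t)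
    then show ?case
      by (cases "\<Phi> t") (auto simp: field_simps)
  qed
  then obtain T where "\<And>t. T \<le> t \<Longrightarrow> ereal (N * t) \<le> \<Phi> t"
    by (auto simp: eventually_at_top_linorder)
  then show thesis
    using that[of "max T 1"] by auto
qed

text \<open>
  Superlinearity makes \<open>\<Phi>\<close> nonnegative beyond some \<open>T\<close>. On \<open>{0..T}\<close>, values tending to \<open>-\<infinity>\<close> would by
  compactness and lower semicontinuity produce a point with value \<open>-\<infinity>\<close>.
\<close>

lemma quasi_young_superlinear_bounded_below:
  assumes \<Phi>: "quasi_young \<Phi>" and super: "((\<lambda>t. \<Phi> t / ereal t) \<longlongrightarrow> \<infinity>) at_top"
  obtains B where "0 \<le> B" "\<And>t. 0 \<le> t \<Longrightarrow> ereal (- B) \<le> \<Phi> t"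
proof -
  obtain T where T: "0 < T" "\<And>t. T \<le> t \<Longrightarrow> ereal (0 * t) \<le> \<Phi> t"
    using superlinear_eventually_ge[OF super, of 0] by blast
  have "\<exists>n::nat. \<forall>t\<ge>0. ereal (- real n) \<le> \<Phi> t"
  proof (rule ccontr)
    assume "\<not> ?thesis"
    then have "\<exists>t\<ge>0. \<Phi> t < ereal (- real n)" for n :: nat
      by (auto simp: not_le)
    then obtain u where u: "\<And>n. 0 \<le> u n" "\<And>n::nat. \<Phi> (u n) < ereal (- real n)"
      by metis
    have "u n \<in> {0..T}" for n
    proof -
      have "u n \<le> T"
      proof (rule ccontr)
        assume "\<not> u n \<le> T"
        then have "0 \<le> \<Phi> (u n)" using T(2)[of "u n"] by (simp add: zero_ereal_def)
        also have "\<dots> < ereal (- real n)" by (rule u)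
        finally show False by (simp add: zero_ereal_def)
      qed
      then show ?thesis using u(1) by simp
    qed
    then obtain l r where r: "strict_mono r" "(u \<circ> r) \<longlonglongrightarrow> l"
      using compact_Icc[of 0 T] unfolding compact_def by blast
    have "\<Phi> l \<le> liminf (\<lambda>k. \<Phi> ((u \<circ> r) k))"
      by (rule quasi_young_lsc[OF \<Phi> _ r(2)]) (use u in auto)
    also have "\<dots> \<le> liminf (\<lambda>k. ereal (- real k))"
    proof (intro Liminf_mono always_eventually allI)
      fix k
      have "\<Phi> (u (r k)) \<le> ereal (- real (r k))" using u(2)[of "r k"] by simp
      also have "\<dots> \<le> ereal (- real k)" using seq_suble[OF r(1), of k] by simp
      finally show "\<Phi> ((u \<circ> r) k) \<le> ereal (- real k)" by simp
    qed
    also have "\<dots> = -\<infinity>"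
    proof (rule lim_imp_Liminf)
      show "(\<lambda>k. ereal (- real k)) \<longlonglongrightarrow> -\<infinity>"
        unfolding tendsto_MInfty
      proof
        fix r :: real
        show "eventually (\<lambda>k. ereal (- real k) < ereal r) sequentially"
          using eventually_gt_at_top[of "nat \<lceil>- r\<rceil>"] by eventually_elim (simp, linarith)
      qed
    qed simp
    finally have "\<Phi> l = -\<infinity>" by simp
    moreover have "0 \<le> l" by (rule LIMSEQ_le_const[OF r(2)]) (use u in auto)
    ultimately show False using \<Phi> by (auto simp: quasi_young_def)
  qed
  then obtain n :: nat where "\<forall>t\<ge>0. ereal (- real n) \<le> \<Phi> t" by blast
  then show thesis using that[of "real n"] by simp
qed

text \<open>
  For large \<open>t\<close> the term \<open>\<gamma> * \<Phi> t\<close> outgrows \<open>b * t\<close>; for the remaining bounded range of \<open>t\<close> a constant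
  suffices. The constant must not depend on the slope \<open>a\<close>, which will be the cost at a varying point.
\<close>

lemma quasi_young_tilt_bounded_below:
  assumes \<Phi>: "quasi_young \<Phi>" and super: "((\<lambda>t. \<Phi> t / ereal t) \<longlongrightarrow> \<infinity>) at_top" and "0 < \<gamma>"
  obtains K where "\<And>a t. \<bar>a\<bar> \<le> b \<Longrightarrow> 0 \<le> t \<Longrightarrow> 0 \<le> ereal (a * t + K) + ereal \<gamma> * \<Phi> t"
proof -
  obtain B where B: "0 \<le> B" "\<And>t. 0 \<le> t \<Longrightarrow> ereal (- B) \<le> \<Phi> t"
    using quasi_young_superlinear_bounded_below[OF \<Phi> super] by blast
  obtain T where T: "0 < T" "\<And>t. T \<le> t \<Longrightarrow> ereal (b / \<gamma> * t) \<le> \<Phi> t"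
    using superlinear_eventually_ge[OF super] by metis
  show thesis
  proof (rule that[of "\<bar>b\<bar> * T + \<gamma> * B"])
    fix a t :: real assume a: "\<bar>a\<bar> \<le> b" and t: "0 \<le> t"
    have at: "- (b * t) \<le> a * t"
      using mult_right_mono[OF abs_le_D2[OF a] t] by simp
    have b: "0 \<le> b" using a by simp
    show "0 \<le> ereal (a * t + (\<bar>b\<bar> * T + \<gamma> * B)) + ereal \<gamma> * \<Phi> t"
    proof (cases "\<Phi> t")
      case (real p)
      have p: "- B \<le> p" using B(2)[OF t] real by simp
      have "0 \<le> a * t + (b * T + \<gamma> * B) + \<gamma> * p"
      proof (cases "T \<le> t")
        case True
        then have "b / \<gamma> * t \<le> p" using T(2) real by fastforce
        then have "b * t \<le> \<gamma> * p" using \<open>0 < \<gamma>\<close> by (simp add: field_simps)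
        moreover have "0 \<le> b * T" "0 \<le> \<gamma> * B" using b T(1) B(1) \<open>0 < \<gamma>\<close> by simp_all
        ultimately show ?thesis using at by linarith
      next
        case False
        then have "b * t \<le> b * T" using b by (intro mult_left_mono) auto
        moreover have "- (\<gamma> * B) \<le> \<gamma> * p"
          using mult_left_mono[OF p, of \<gamma>] \<open>0 < \<gamma>\<close> by simp
        ultimately show ?thesis using at by linarith
      qed
      then show ?thesis using b real by simp
    next
      case PInf
      then show ?thesis using \<open>0 < \<gamma>\<close> by simp
    next
      case MInf
      then show ?thesis using \<Phi> t by (auto simp: quasi_young_def)
    qed
  qed
qed

lemma e2ennreal_add:
  "0 \<le> p \<Longrightarrow> 0 \<le> q \<Longrightarrow> e2ennreal (p + q) = e2ennreal p + e2ennreal q"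
  by (metis e2ennreal_enn2ereal enn2ereal_e2ennreal plus_ennreal.rep_eq)

text \<open>
  Values are taken in \<^typ>\<open>ennreal\<close> so that Fatou's lemma is directly applicable; \<open>K\<close> will always be
  such that \<^const>\<open>e2ennreal\<close> does not truncate.
\<close>

definition tilted_integrand :: "(real \<Rightarrow> ereal) \<Rightarrow> real \<Rightarrow> ('a \<Rightarrow> real) \<Rightarrow> real \<Rightarrow> 'a \<Rightarrow> real \<Rightarrow> ennreal" where
  "tilted_integrand \<Phi> \<gamma> c K z t = e2ennreal (ereal (c z * t + K) + ereal \<gamma> * \<Phi> t)"

lemma superlinear_energy_tilted_integrand:
  assumes "finite_measure M" and \<Phi>: "quasi_young \<Phi>" and super: "((\<lambda>t. \<Phi> t / ereal t) \<longlongrightarrow> \<infinity>) at_top"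
    and \<gamma>: "0 < \<gamma>" and c[measurable]: "c \<in> borel_measurable M"
    and cb: "\<And>z. z \<in> space M \<Longrightarrow> \<bar>c z\<bar> \<le> b"
    and K: "\<And>a t. \<bar>a\<bar> \<le> b \<Longrightarrow> 0 \<le> t \<Longrightarrow> 0 \<le> ereal (a * t + K) + ereal \<gamma> * \<Phi> t"
  shows "superlinear_energy M (tilted_integrand \<Phi> \<gamma> c K)"
proof -
  interpret finite_measure M by fact
  show ?thesis
  proof
    fix f :: "'a \<Rightarrow> real" assume f[measurable]: "f \<in> borel_measurable M" and f0: "\<And>x. 0 \<le> f x"
    note quasi_young_measurable[OF \<Phi> f f0, measurable]
    show "(\<lambda>x. tilted_integrand \<Phi> \<gamma> c K x (f x)) \<in> borel_measurable M"
      unfolding tilted_integrand_def by measurable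
  next
    fix x and s t :: real assume x: "x \<in> space M" and s: "0 \<le> s" and t: "0 \<le> t"
    let ?p = "\<lambda>t. ereal (c x * t + K) + ereal \<gamma> * \<Phi> t"
    have "\<Phi> ((s + t) / 2) \<le> ereal (1 / 2) * \<Phi> s + ereal (1 / 2) * \<Phi> t"
      using quasi_young_convex[OF \<Phi> s t, of "1 / 2"] by (simp add: add_divide_distrib)
    moreover have "\<Phi> r \<noteq> -\<infinity>" if "0 \<le> r" for r
      using \<Phi> that by (auto simp: quasi_young_def)
    moreover have "q * (\<gamma> * 8) \<le> q' * (\<gamma> * 4) + q'' * (\<gamma> * 4)" if "q * 2 \<le> q' + q''" for q q' q''
      using mult_left_mono[OF that, of "\<gamma> * 4"] \<gamma> by (simp add: algebra_simps)
    ultimately have "?p ((s + t) / 2) + ?p ((s + t) / 2) \<le> ?p s + ?p t"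
      using \<gamma> s t
      by (cases "\<Phi> s"; cases "\<Phi> t"; cases "\<Phi> ((s + t) / 2)") (auto simp: field_simps)
    then have "e2ennreal (?p ((s + t) / 2) + ?p ((s + t) / 2)) \<le> e2ennreal (?p s + ?p t)"
      by (rule e2ennreal_mono)
    then show "2 * tilted_integrand \<Phi> \<gamma> c K x ((s + t) / 2)
        \<le> tilted_integrand \<Phi> \<gamma> c K x s + tilted_integrand \<Phi> \<gamma> c K x t"
      unfolding tilted_integrand_def
      using K[OF cb[OF x] s] K[OF cb[OF x] t] K[OF cb[OF x], of "(s + t) / 2"] s t
      by (simp add: e2ennreal_add mult_2)
  next
    fix x and u :: "nat \<Rightarrow> real" and t assume x: "x \<in> space M" and u: "\<And>k. 0 \<le> u k" "u \<longlonglongrightarrow> t"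
    let ?p = "\<lambda>t. ereal (c x * t + K) + ereal \<gamma> * \<Phi> t"
    have "?p t \<le> ereal (c x * t + K) + ereal \<gamma> * liminf (\<lambda>k. \<Phi> (u k))"
      using quasi_young_lsc[OF \<Phi> u] \<gamma> by (intro add_left_mono ereal_mult_left_mono) auto
    also have "\<dots> = ereal (c x * t + K) + liminf (\<lambda>k. ereal \<gamma> * \<Phi> (u k))"
      using \<gamma> by (subst Liminf_ereal_mult_left) auto
    also have "\<dots> = liminf (\<lambda>k. ?p (u k))"
      using u(2) by (intro ereal_liminf_lim_add[symmetric]) (auto intro!: tendsto_intros)
    finally have "e2ennreal (?p t) \<le> e2ennreal (liminf (\<lambda>k. ?p (u k)))"
      by (rule e2ennreal_mono)
    also have "\<dots> = liminf (\<lambda>k. e2ennreal (?p (u k)))"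
      by (rule Liminf_compose_continuous_mono[symmetric]) (auto simp: continuous_on_e2ennreal mono_def e2ennreal_mono)
    finally show "tilted_integrand \<Phi> \<gamma> c K x t \<le> liminf (\<lambda>k. tilted_integrand \<Phi> \<gamma> c K x (u k))"
      unfolding tilted_integrand_def .
  next
    fix N
    obtain T where T: "0 < T" "\<And>t. T \<le> t \<Longrightarrow> ereal ((N + b + \<bar>K\<bar>) / \<gamma> * t) \<le> \<Phi> t"
      using superlinear_eventually_ge[OF super] by metis
    have "ennreal (N * t) \<le> tilted_integrand \<Phi> \<gamma> c K x t" if x: "x \<in> space M" and t: "max 1 T \<le> t" for x t
    proof -
      have "ereal (N * t) \<le> ereal (c x * t + K) + ereal \<gamma> * \<Phi> t"
      proof (cases "\<Phi> t")
        case (real p)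
        then have "(N + b + \<bar>K\<bar>) / \<gamma> * t \<le> p" using T(2)[of t] t by simp
        then have "(N + b + \<bar>K\<bar>) * t \<le> \<gamma> * p" using \<gamma> by (simp add: field_simps)
        moreover have "- (b * t) \<le> c x * t"
          using mult_right_mono[OF abs_le_D2[OF cb[OF x]], of t] t by simp
        moreover have "\<bar>K\<bar> \<le> \<bar>K\<bar> * t" using t by (simp add: mult_le_cancel_left1)
        ultimately have "N * t \<le> c x * t + K + \<gamma> * p" by (simp add: distrib_right)
        then show ?thesis using real by simp
      qed (use T(2)[of t] t \<gamma> in auto)
      then show ?thesis
        unfolding tilted_integrand_def e2ennreal_ereal[symmetric] by (rule e2ennreal_mono)
    qed
    then show "\<exists>T. \<forall>x\<in>space M. \<forall>t\<ge>T. ennreal (N * t) \<le> tilted_integrand \<Phi> \<gamma> c K x t"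
      by blast
  qed
qed


lemma tilted_integrand_strict_midpoint:
  assumes \<Phi>: "quasi_young \<Phi>" and strict: "strictly_convex \<Phi>" and \<gamma>: "0 < \<gamma>"
    and K: "\<And>t. 0 \<le> t \<Longrightarrow> 0 \<le> ereal (c x * t + K) + ereal \<gamma> * \<Phi> t"
    and s: "0 \<le> s" and t: "0 \<le> t" and "s \<noteq> t"
    and fin: "tilted_integrand \<Phi> \<gamma> c K x s < \<infinity>" "tilted_integrand \<Phi> \<gamma> c K x t < \<infinity>"
  shows "2 * tilted_integrand \<Phi> \<gamma> c K x ((s + t) / 2)
    < tilted_integrand \<Phi> \<gamma> c K x s + tilted_integrand \<Phi> \<gamma> c K x t"
proof -
  let ?p = "\<lambda>t. ereal (c x * t + K) + ereal \<gamma> * \<Phi> t"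
  have minf: "\<Phi> r \<noteq> -\<infinity>" if "0 \<le> r" for r
    using \<Phi> that by (auto simp: quasi_young_def)
  have finite: "\<Phi> s < \<infinity>" "\<Phi> t < \<infinity>"
    using fin \<gamma> by (cases "\<Phi> s"; cases "\<Phi> t"; simp add: tilted_integrand_def)+
  have half: "1 - 1 / 2 = (1 / 2 :: real)" by simp
  have "\<Phi> ((1 - 1 / 2) * s + 1 / 2 * t) < ereal (1 - 1 / 2) * \<Phi> s + ereal (1 / 2) * \<Phi> t"
    using s t \<open>s \<noteq> t\<close> finite by (intro strict[unfolded strictly_convex_def, rule_format]) auto
  then have "\<Phi> ((s + t) / 2) < ereal (1 / 2) * \<Phi> s + ereal (1 / 2) * \<Phi> t"
    unfolding half by (simp add: add_divide_distrib)
  moreover have "q * (\<gamma> * 8) < q' * (\<gamma> * 4) + q'' * (\<gamma> * 4)" if "q * 2 < q' + q''" for q q' q''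
    using mult_strict_left_mono[OF that, of "\<gamma> * 4"] \<gamma> by (simp add: algebra_simps)
  ultimately have lt: "?p ((s + t) / 2) + ?p ((s + t) / 2) < ?p s + ?p t"
    using \<gamma> s t minf[OF s] minf[OF t] minf[of "(s + t) / 2"] finite
    by (cases "\<Phi> s"; cases "\<Phi> t"; cases "\<Phi> ((s + t) / 2)") (auto simp: field_simps)
  have "enn2ereal (e2ennreal (?p ((s + t) / 2) + ?p ((s + t) / 2))) < enn2ereal (e2ennreal (?p s + ?p t))"
    using lt K[OF s] K[OF t] K[of "(s + t) / 2"] s t by (simp add: enn2ereal_e2ennreal)
  then show ?thesis
    unfolding tilted_integrand_def using K[OF s] K[OF t] K[of "(s + t) / 2"] s t
    by (simp add: e2ennreal_add mult_2 less_ennreal.rep_eq)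
qed

section \<open>Extended-valued integrals and Orlicz spaces\<close>

text \<open>
  All four positive and negative parts can be moved to the side on which they are added, which gives a
  pointwise identity of nonnegative functions. Only the positive part of \<open>u\<close> may have an infinite
  integral, so the integrated identity can be solved for the integral of the sum.
\<close>

lemma ereal_integral_add_real:
  fixes w :: "'a \<Rightarrow> real" and u :: "'a \<Rightarrow> ereal"
  assumes [measurable]: "u \<in> borel_measurable M" and w: "integrable M w"
    and neg: "(\<integral>\<^sup>+x. e2ennreal (- u x) \<partial>M) < \<infinity>"
    and nonneg: "\<And>x. x \<in> space M \<Longrightarrow> 0 \<le> ereal (w x) + u x"
  shows "enn2ereal (\<integral>\<^sup>+x. e2ennreal (ereal (w x) + u x) \<partial>M) = ereal (\<integral>x. w x \<partial>M) + ereal_integral M u"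
proof -
  have [measurable]: "w \<in> borel_measurable M" using w by simp
  define W where "W = (\<integral>\<^sup>+x. e2ennreal (ereal (w x) + u x) \<partial>M)"
  define a where "a = (\<integral>\<^sup>+x. ennreal (w x) \<partial>M)"
  define b where "b = (\<integral>\<^sup>+x. ennreal (- w x) \<partial>M)"
  define p where "p = (\<integral>\<^sup>+x. e2ennreal (u x) \<partial>M)"
  define q where "q = (\<integral>\<^sup>+x. e2ennreal (- u x) \<partial>M)"
  have "e2ennreal (ereal (w x) + u x) + (ennreal (- w x) + e2ennreal (- u x)) = ennreal (w x) + e2ennreal (u x)"
    if "x \<in> space M" for x
  proof (cases "u x")
    case (real r)
    then have "0 \<le> w x + r" using nonneg[OF that] by simp
    then show ?thesis
      using real by (cases "0 \<le> w x"; cases "0 \<le> r") (auto simp: ennreal_neg simp flip: ennreal_plus)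
  qed (use nonneg[OF that] in auto)
  then have "(\<integral>\<^sup>+x. e2ennreal (ereal (w x) + u x) + (ennreal (- w x) + e2ennreal (- u x)) \<partial>M)
      = (\<integral>\<^sup>+x. ennreal (w x) + e2ennreal (u x) \<partial>M)"
    by (rule nn_integral_cong)
  then have eq: "W + (b + q) = a + p"
    by (simp add: nn_integral_add W_def a_def b_def p_def q_def)
  have "a < \<infinity>" "b < \<infinity>" "q < \<infinity>"
    using w neg by (auto simp: real_integrable_def a_def b_def q_def less_top)
  then obtain a' b' q' where r: "a = ennreal a'" "b = ennreal b'" "q = ennreal q'" "0 \<le> a'" "0 \<le> b'" "0 \<le> q'"
    by (cases a; cases b; cases q) auto
  have "(\<integral>x. w x \<partial>M) = a' - b'"
    using real_lebesgue_integral_def[OF w] r by (simp flip: a_def b_def)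
  moreover have "enn2ereal W = ereal (a' - b') + (enn2ereal p - enn2ereal q)"
    using eq r
    by (cases W; cases p) (auto simp: enn2ereal_ennreal simp flip: ennreal_plus)
  ultimately show ?thesis
    by (simp add: ereal_integral_def W_def p_def q_def)
qed

lemma ereal_integral_cmult:
  assumes [measurable]: "u \<in> borel_measurable M" and "0 \<le> \<gamma>"
    and neg: "(\<integral>\<^sup>+x. e2ennreal (- u x) \<partial>M) < \<infinity>"
  shows "ereal_integral M (\<lambda>x. ereal \<gamma> * u x) = ereal \<gamma> * ereal_integral M u"
proof -
  have *: "e2ennreal (ereal \<gamma> * v) = ennreal \<gamma> * e2ennreal v" for v
    using \<open>0 \<le> \<gamma>\<close>
    by (cases v; cases "\<gamma> = 0") (auto simp: ennreal_mult' ennreal_mult_top e2ennreal_neg)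
  have "(\<integral>\<^sup>+x. e2ennreal (- (ereal \<gamma> * u x)) \<partial>M) = ennreal \<gamma> * (\<integral>\<^sup>+x. e2ennreal (- u x) \<partial>M)"
    using *[of "- u _"] by (simp add: nn_integral_cmult)
  moreover have "(\<integral>\<^sup>+x. e2ennreal (ereal \<gamma> * u x) \<partial>M) = ennreal \<gamma> * (\<integral>\<^sup>+x. e2ennreal (u x) \<partial>M)"
    by (simp add: * nn_integral_cmult)
  ultimately show ?thesis
    using neg \<open>0 \<le> \<gamma>\<close> unfolding ereal_integral_def
    by (cases "\<integral>\<^sup>+x. e2ennreal (- u x) \<partial>M"; cases "\<integral>\<^sup>+x. e2ennreal (u x) \<partial>M"; cases "\<gamma> = 0")
       (auto simp: enn2ereal_ennreal ennreal_mult_top right_diff_distrib simp flip: ennreal_mult)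
qed

lemma bounded_below_negative_part:
  assumes "finite_measure M" and "\<And>x. x \<in> space M \<Longrightarrow> ereal (- b) \<le> u x"
  shows "(\<integral>\<^sup>+x. e2ennreal (- u x) \<partial>M) < \<infinity>"
proof -
  interpret finite_measure M by fact
  have "e2ennreal (- u x) \<le> ennreal b" if "x \<in> space M" for x
  proof -
    have "- u x \<le> ereal b" using assms(2)[OF that] by (cases "u x") auto
    then show ?thesis using e2ennreal_mono by fastforce
  qed
  then have "(\<integral>\<^sup>+x. e2ennreal (- u x) \<partial>M) \<le> (\<integral>\<^sup>+x. ennreal b \<partial>M)"
    by (rule nn_integral_mono)
  also have "\<dots> < \<infinity>" by (simp add: emeasure_eq_measure ennreal_mult_less_top)
  finally show ?thesis .
qed

text \<open>
  Scaling by \<open>1 / k\<close> with \<open>k \<ge> 1\<close> divides the integral of the positive part of \<open>\<Phi> \<circ> f\<close> by at least \<open>k\<close>,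
  hence brings it below \<open>1\<close> for large \<open>k\<close>.
\<close>

lemma orlicz_space_if_positive_part_integrable:
  assumes \<Phi>: "quasi_young \<Phi>" and f[measurable]: "f \<in> borel_measurable M" and f0: "\<And>x. 0 \<le> f x"
    and fin: "(\<integral>\<^sup>+x. e2ennreal (\<Phi> (f x)) \<partial>M) < \<infinity>"
  shows "f \<in> orlicz_space \<Phi> M"
proof -
  obtain r where r: "(\<integral>\<^sup>+x. e2ennreal (\<Phi> (f x)) \<partial>M) = ennreal r" "0 \<le> r"
    using fin by (cases "\<integral>\<^sup>+x. e2ennreal (\<Phi> (f x)) \<partial>M") auto
  define k where "k = max 1 r"
  have k: "1 \<le> k" "r / k \<le> 1" by (auto simp: k_def)
  note quasi_young_measurable[OF \<Phi> f f0, measurable]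
  have "e2ennreal (\<Phi> (\<bar>f x\<bar> / k)) \<le> ennreal (1 / k) * e2ennreal (\<Phi> (f x))" for x
  proof -
    have "\<Phi> (1 / k * f x) \<le> ereal (1 / k) * \<Phi> (f x)"
      using k by (intro quasi_young_shrink \<Phi> f0) auto
    then have "e2ennreal (\<Phi> (\<bar>f x\<bar> / k)) \<le> e2ennreal (ereal (1 / k) * \<Phi> (f x))"
      using f0[of x] by (intro e2ennreal_mono) simp
    also have "\<dots> = ennreal (1 / k) * e2ennreal (\<Phi> (f x))"
      using k by (cases "\<Phi> (f x)") (auto simp: ennreal_mult_top e2ennreal_neg simp flip: ennreal_mult')
    finally show ?thesis .
  qed
  then have "(\<integral>\<^sup>+x. e2ennreal (\<Phi> (\<bar>f x\<bar> / k)) \<partial>M) \<le> (\<integral>\<^sup>+x. ennreal (1 / k) * e2ennreal (\<Phi> (f x)) \<partial>M)"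
    by (intro nn_integral_mono)
  also have "\<dots> = ennreal (r / k)"
    using r k by (simp add: nn_integral_cmult flip: ennreal_mult')
  also have "\<dots> \<le> 1" using k by (simp add: ennreal_le_1)
  finally have le: "(\<integral>\<^sup>+x. e2ennreal (\<Phi> (\<bar>f x\<bar> / k)) \<partial>M) \<le> 1" .
  have "ereal_integral M (\<lambda>x. \<Phi> (\<bar>f x\<bar> / k)) \<le> enn2ereal (\<integral>\<^sup>+x. e2ennreal (\<Phi> (\<bar>f x\<bar> / k)) \<partial>M)"
    unfolding ereal_integral_def by (simp add: ereal_diff_le_self)
  also have "\<dots> \<le> enn2ereal 1"
    using le by (simp add: less_eq_ennreal.rep_eq)
  finally have "luxemburg_norm \<Phi> M f \<le> ereal k"
    unfolding luxemburg_norm_def using k by (intro Inf_lower) (auto simp: one_ennreal.rep_eq)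
  then show ?thesis
    unfolding orlicz_space_def using f by (auto intro: le_less_trans)
qed

section \<open>Couplings as densities with prescribed cylinder masses\<close>

lemma sets_restrict_borel_pair:
  fixes A :: "'a::second_countable_topology set" and B :: "'b::second_countable_topology set"
  shows "sets (restrict_space borel A \<Otimes>\<^sub>M restrict_space borel B) = sets (restrict_space borel (A \<times> B))"
    (is "sets ?P = sets ?R")
proof
  have sp: "space ?P = A \<times> B" "space ?R = A \<times> B"
    by (auto simp: space_pair_measure space_restrict_space)
  have "(\<lambda>z. z) \<in> ?R \<rightarrow>\<^sub>M ?P"
  proof -
    have "fst \<in> ?R \<rightarrow>\<^sub>M borel" "snd \<in> ?R \<rightarrow>\<^sub>M borel"
      by (auto intro!: measurable_restrict_space1 simp flip: borel_prod)
    then have "fst \<in> ?R \<rightarrow>\<^sub>M restrict_space borel A" "snd \<in> ?R \<rightarrow>\<^sub>M restrict_space borel B"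
      by (auto intro!: measurable_restrict_space2 simp: space_restrict_space)
    then have "(\<lambda>z. (fst z, snd z)) \<in> ?R \<rightarrow>\<^sub>M ?P" by (rule measurable_Pair)
    then show ?thesis by simp
  qed
  then show "sets ?P \<subseteq> sets ?R"
    using sets.sets_into_space[of _ ?P] sp by (fastforce dest: measurable_sets simp: Int_absorb2)
  have "(\<lambda>z. z) \<in> ?P \<rightarrow>\<^sub>M borel"
  proof -
    have "(\<lambda>x. x) \<in> restrict_space borel A \<rightarrow>\<^sub>M borel" "(\<lambda>x. x) \<in> restrict_space borel B \<rightarrow>\<^sub>M borel"
      by (auto intro: measurable_restrict_space1)
    from measurable_compose[OF measurable_fst this(1)] measurable_compose[OF measurable_snd this(2)]
    have "(\<lambda>z. (fst z, snd z)) \<in> ?P \<rightarrow>\<^sub>M borel \<Otimes>\<^sub>M borel" by (rule measurable_Pair)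
    then show ?thesis by (simp add: borel_prod)
  qed
  then show "sets ?R \<subseteq> sets ?P"
    using measurable_sets[of "\<lambda>z. z" ?P borel] sp by (auto simp: sets_restrict_space Int_commute)
qed

lemma dens_nonneg: "0 \<le> dens \<nu> \<mu> x"
  by (simp add: dens_def)

lemma dens_measurable [measurable]: "dens \<nu> \<mu> \<in> borel_measurable \<nu>"
  unfolding dens_def by measurable

lemma density_dens:
  assumes "sigma_finite_measure \<nu>" "sigma_finite_measure \<mu>" and ac: "absolutely_continuous \<nu> \<mu>" "sets \<mu> = sets \<nu>"
  shows "density \<nu> (\<lambda>x. ennreal (dens \<nu> \<mu> x)) = \<mu>"
proof -
  interpret sigma_finite_measure \<nu> by fact
  have "AE x in \<nu>. ennreal (dens \<nu> \<mu> x) = RN_deriv \<nu> \<mu> x"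
    using RN_deriv_finite[OF assms(2) ac] by eventually_elim (simp add: dens_def less_top)
  then have "density \<nu> (\<lambda>x. ennreal (dens \<nu> \<mu> x)) = density \<nu> (RN_deriv \<nu> \<mu>)"
    by (intro density_cong) auto
  then show ?thesis using density_RN_deriv[OF ac] by simp
qed

lemma dens_density:
  assumes "sigma_finite_measure \<nu>" and [measurable]: "f \<in> borel_measurable \<nu>" and "\<And>x. 0 \<le> f x"
  shows "AE x in \<nu>. dens \<nu> (density \<nu> (\<lambda>x. ennreal (f x))) x = f x"
proof -
  interpret sigma_finite_measure \<nu> by fact
  have "AE x in \<nu>. ennreal (f x) = RN_deriv \<nu> (density \<nu> (\<lambda>x. ennreal (f x))) x"
    by (rule RN_deriv_unique) auto
  then show ?thesis
    by eventually_elim (metis assms(3) dens_def enn2real_ennreal)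
qed

locale transport_data = lam1: finite_measure lam1 + lam2: finite_measure lam2 +
    \<mu>1: prob_space \<mu>1 + \<mu>2: prob_space \<mu>2
  for lam1 \<mu>1 :: "'a::second_countable_topology measure"
    and lam2 \<mu>2 :: "'b::second_countable_topology measure" +
  assumes sets_lam1: "sets lam1 = sets (restrict_space borel (space lam1))"
    and sets_lam2: "sets lam2 = sets (restrict_space borel (space lam2))"
    and sets_\<mu>1: "sets \<mu>1 = sets lam1" and ac1: "absolutely_continuous lam1 \<mu>1"
    and sets_\<mu>2: "sets \<mu>2 = sets lam2" and ac2: "absolutely_continuous lam2 \<mu>2"
begin

abbreviation lam where "lam \<equiv> lam1 \<Otimes>\<^sub>M lam2"

sublocale pair_sigma_finite lam1 lam2 ..
sublocale lam: finite_measure lam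
  by (rule finite_measure_pair_measure) (rule lam1.finite_measure_axioms lam2.finite_measure_axioms)+
sublocale indep: pair_prob_space \<mu>1 \<mu>2 ..

lemma sets_lam: "sets (restrict_space borel (space lam1 \<times> space lam2)) = sets lam"
  using sets_lam1 sets_lam2 by (simp flip: sets_restrict_borel_pair cong: sets_pair_measure_cong)

definition cylinders :: "('a \<times> 'b) set set" where
  "cylinders = (\<lambda>A. A \<times> space lam2) ` sets lam1 \<union> (\<lambda>B. space lam1 \<times> B) ` sets lam2"

lemma cylinders_sets: "cylinders \<subseteq> sets lam"
  by (auto simp: cylinders_def)

lemma space_cylinder: "space lam \<in> cylinders"
  by (auto simp: cylinders_def space_pair_measure)

lemma cylinders_Compl: "B \<in> cylinders \<Longrightarrow> space lam - B \<in> cylinders"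
proof -
  assume "B \<in> cylinders"
  then consider A where "B = A \<times> space lam2" "A \<in> sets lam1" | A where "B = space lam1 \<times> A" "A \<in> sets lam2"
    by (auto simp: cylinders_def)
  then show ?thesis
  proof cases
    case 1
    then have "space lam - B = (space lam1 - A) \<times> space lam2" by (auto simp: space_pair_measure)
    then show ?thesis using 1 by (auto simp: cylinders_def)
  next
    case 2
    then have "space lam - B = space lam1 \<times> (space lam2 - A)" by (auto simp: space_pair_measure)
    then show ?thesis using 2 by (auto simp: cylinders_def)
  qed
qed

lemma space_\<mu>: "space \<mu>1 = space lam1" "space \<mu>2 = space lam2"
  using sets_\<mu>1 sets_\<mu>2 by (auto dest: sets_eq_imp_space_eq)

lemma emeasure_indep_cylinder:
  "A \<in> sets lam1 \<Longrightarrow> emeasure (\<mu>1 \<Otimes>\<^sub>M \<mu>2) (A \<times> space lam2) = emeasure \<mu>1 A"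
  "B \<in> sets lam2 \<Longrightarrow> emeasure (\<mu>1 \<Otimes>\<^sub>M \<mu>2) (space lam1 \<times> B) = emeasure \<mu>2 B"
  using \<mu>2.emeasure_pair_measure_Times[of A \<mu>1 "space lam2"] \<mu>2.emeasure_pair_measure_Times[of "space lam1" \<mu>1 B]
    \<mu>1.emeasure_space_1 \<mu>2.emeasure_space_1
  by (simp_all add: sets_\<mu>1 sets_\<mu>2 space_\<mu>)

text \<open>
  The product coupling has the right marginals, so its values on cylinders are the masses to prescribe.
  This avoids defining a set function by cases on the shape of a cylinder.
\<close>

abbreviation couplings :: "('a \<times> 'b \<Rightarrow> real) set" where
  "couplings \<equiv> densities_with_masses lam cylinders (emeasure (\<mu>1 \<Otimes>\<^sub>M \<mu>2))"

lemma feasible_iff: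
  "\<pi> \<in> ot_feasible lam1 lam2 \<mu>1 \<mu>2 \<longleftrightarrow>
     sets \<pi> = sets lam \<and> absolutely_continuous lam \<pi> \<and>
     (\<forall>B\<in>cylinders. emeasure \<pi> B = emeasure (\<mu>1 \<Otimes>\<^sub>M \<mu>2) B)"
proof (cases "sets \<pi> = sets lam")
  case True
  note sets_eq_imp_space_eq[OF True, simp]
  note True[measurable_cong]
  have dist1: "distr \<pi> lam1 fst = \<mu>1 \<longleftrightarrow> (\<forall>A\<in>sets lam1. emeasure \<pi> (A \<times> space lam2) = emeasure \<mu>1 A)"
  proof -
    have *: "emeasure (distr \<pi> lam1 fst) A = emeasure \<pi> (A \<times> space lam2)" if "A \<in> sets lam1" for A
      using that sets.sets_into_space[OF that]
      by (subst emeasure_distr) (auto intro!: arg_cong[where f = "emeasure \<pi>"] simp: space_pair_measure)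
    show ?thesis
    proof
      assume "\<forall>A\<in>sets lam1. emeasure \<pi> (A \<times> space lam2) = emeasure \<mu>1 A"
      then show "distr \<pi> lam1 fst = \<mu>1" by (intro measure_eqI) (auto simp: sets_\<mu>1 *)
    qed (use * in auto)
  qed
  have dist2: "distr \<pi> lam2 snd = \<mu>2 \<longleftrightarrow> (\<forall>A\<in>sets lam2. emeasure \<pi> (space lam1 \<times> A) = emeasure \<mu>2 A)"
  proof -
    have *: "emeasure (distr \<pi> lam2 snd) A = emeasure \<pi> (space lam1 \<times> A)" if "A \<in> sets lam2" for A
      using that sets.sets_into_space[OF that]
      by (subst emeasure_distr) (auto intro!: arg_cong[where f = "emeasure \<pi>"] simp: space_pair_measure)
    show ?thesis
    proof
      assume "\<forall>A\<in>sets lam2. emeasure \<pi> (space lam1 \<times> A) = emeasure \<mu>2 A"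
      then show "distr \<pi> lam2 snd = \<mu>2" by (intro measure_eqI) (auto simp: sets_\<mu>2 *)
    qed (use * in auto)
  qed
  have cyl: "(\<forall>B\<in>cylinders. emeasure \<pi> B = emeasure (\<mu>1 \<Otimes>\<^sub>M \<mu>2) B) \<longleftrightarrow>
      (\<forall>A\<in>sets lam1. emeasure \<pi> (A \<times> space lam2) = emeasure \<mu>1 A) \<and>
      (\<forall>A\<in>sets lam2. emeasure \<pi> (space lam1 \<times> A) = emeasure \<mu>2 A)"
    by (auto simp: cylinders_def emeasure_indep_cylinder)
  have "prob_space \<pi>" if "\<forall>A\<in>sets lam1. emeasure \<pi> (A \<times> space lam2) = emeasure \<mu>1 A"
  proof
    show "emeasure \<pi> (space \<pi>) = 1"
      using that[rule_format, of "space lam1"] \<mu>1.emeasure_space_1 by (simp add: space_pair_measure space_\<mu>)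
  qed
  then show ?thesis
    unfolding ot_feasible_def prob_measures_on_def mem_Collect_eq dist1 dist2 cyl sets_lam
    using True by blast
qed (auto simp: ot_feasible_def prob_measures_on_def sets_lam)

lemma indep_feasible: "\<mu>1 \<Otimes>\<^sub>M \<mu>2 \<in> ot_feasible lam1 lam2 \<mu>1 \<mu>2"
proof -
  have 1: "density lam1 (RN_deriv lam1 \<mu>1) = \<mu>1" by (rule lam1.density_RN_deriv[OF ac1 sets_\<mu>1])
  have 2: "density lam2 (RN_deriv lam2 \<mu>2) = \<mu>2" by (rule lam2.density_RN_deriv[OF ac2 sets_\<mu>2])
  have "\<mu>1 \<Otimes>\<^sub>M \<mu>2 = density lam (\<lambda>(x, y). RN_deriv lam1 \<mu>1 x * RN_deriv lam2 \<mu>2 y)"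
    using pair_measure_density[of "RN_deriv lam1 \<mu>1" lam1 "RN_deriv lam2 \<mu>2" lam2]
      lam2.sigma_finite_measure_axioms \<mu>2.sigma_finite_measure_axioms
    by (simp add: 1 2)
  then have "absolutely_continuous lam (\<mu>1 \<Otimes>\<^sub>M \<mu>2)"
    by (simp add: absolutely_continuousI_density)
  then show ?thesis
    by (simp add: feasible_iff sets_\<mu>1 sets_\<mu>2 cong: sets_pair_measure_cong)
qed

lemma feasible_density_dens:
  assumes "\<pi> \<in> ot_feasible lam1 lam2 \<mu>1 \<mu>2"
  shows "density lam (\<lambda>z. ennreal (dens lam \<pi> z)) = \<pi>"
proof (rule density_dens)
  have "prob_space \<pi>" using assms by (auto simp: ot_feasible_def prob_measures_on_def)
  then interpret prob_space \<pi> .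
  show "sigma_finite_measure \<pi>" ..
  show "absolutely_continuous lam \<pi>" "sets \<pi> = sets lam" using assms by (auto simp: feasible_iff)
qed standard

lemma density_feasible_iff:
  assumes [measurable]: "f \<in> borel_measurable lam" and "\<And>z. 0 \<le> f z"
  shows "density lam (\<lambda>z. ennreal (f z)) \<in> ot_feasible lam1 lam2 \<mu>1 \<mu>2 \<longleftrightarrow> f \<in> couplings"
proof -
  have "emeasure (density lam (\<lambda>z. ennreal (f z))) B = (\<integral>\<^sup>+z\<in>B. ennreal (f z) \<partial>lam)" if "B \<in> cylinders" for B
    using that cylinders_sets by (intro emeasure_density) auto
  then show ?thesis
    using assms by (auto simp: feasible_iff densities_with_masses_def absolutely_continuousI_density)
qed

lemma dens_feasible:
  assumes "\<pi> \<in> ot_feasible lam1 lam2 \<mu>1 \<mu>2"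
  shows "dens lam \<pi> \<in> couplings"
  using density_feasible_iff[OF dens_measurable dens_nonneg, of \<pi>] feasible_density_dens[OF assms] assms
  by simp

end

section \<open>The regularized transport problem\<close>

locale regularized_transport = transport_data lam1 \<mu>1 lam2 \<mu>2
  for lam1 \<mu>1 :: "'a::second_countable_topology measure"
    and lam2 \<mu>2 :: "'b::second_countable_topology measure" +
  fixes \<Phi> :: "real \<Rightarrow> ereal" and \<gamma> b K :: real and c :: "'a \<times> 'b \<Rightarrow> real"
  assumes \<Phi>: "quasi_young \<Phi>" and superlinear: "((\<lambda>t. \<Phi> t / ereal t) \<longlongrightarrow> \<infinity>) at_top"
    and \<gamma>: "0 < \<gamma>"
    and c_measurable [measurable]: "c \<in> borel_measurable lam"
    and c_bounded: "\<And>z. z \<in> space lam \<Longrightarrow> \<bar>c z\<bar> \<le> b"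
    and K: "\<And>a t. \<bar>a\<bar> \<le> b \<Longrightarrow> 0 \<le> t \<Longrightarrow> 0 \<le> ereal (a * t + K) + ereal \<gamma> * \<Phi> t"
begin

sublocale superlinear_energy lam "tilted_integrand \<Phi> \<gamma> c K"
  using lam.finite_measure_axioms \<Phi> superlinear \<gamma> c_measurable c_bounded K
  by (rule superlinear_energy_tilted_integrand)

abbreviation feasible where "feasible \<equiv> ot_feasible lam1 lam2 \<mu>1 \<mu>2"
abbreviation objective where "objective \<equiv> ot_objective \<Phi> \<gamma> c lam1 lam2"
abbreviation minimizer where "minimizer \<equiv> ot_minimizer \<Phi> \<gamma> c lam1 lam2 \<mu>1 \<mu>2"

lemma negative_part_finite:
  assumes "\<And>z. 0 \<le> f z"
  shows "(\<integral>\<^sup>+z. e2ennreal (- \<Phi> (f z)) \<partial>lam) < \<infinity>"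
proof -
  obtain B where "\<And>t. 0 \<le> t \<Longrightarrow> ereal (- B) \<le> \<Phi> t"
    using quasi_young_superlinear_bounded_below[OF \<Phi> superlinear] by blast
  then show ?thesis
    using assms by (intro bounded_below_negative_part[OF lam.finite_measure_axioms, of B]) auto
qed

lemma objective_eq:
  "objective \<pi> = ereal (\<integral>z. c z \<partial>\<pi>) + ereal \<gamma> * ereal_integral lam (\<lambda>z. \<Phi> (dens lam \<pi> z))"
  by (simp add: ot_objective_def extend_inf_def not_less[THEN iffD2, OF dens_nonneg])

text \<open>
  The constant \<open>K\<close> in the integrand contributes \<open>K\<close> times the total mass of the reference measure, the
  same number for every coupling. Objective and energy therefore have the same minimizers.
\<close>

lemma objective_eq_energy:
  assumes \<pi>: "\<pi> \<in> feasible"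
  shows "objective \<pi> + ereal (K * measure lam (space lam)) = enn2ereal (energy (dens lam \<pi>))"
proof -
  define f where "f = dens lam \<pi>"
  have f[measurable]: "f \<in> borel_measurable lam" and f0: "\<And>z. 0 \<le> f z"
    unfolding f_def by (auto simp: dens_nonneg)
  note \<Phi>f = quasi_young_measurable[OF \<Phi> f f0, measurable]
  interpret \<pi>: prob_space \<pi> using \<pi> by (auto simp: ot_feasible_def prob_measures_on_def)
  have \<pi>f: "density lam (\<lambda>z. ennreal (f z)) = \<pi>"
    unfolding f_def by (rule feasible_density_dens[OF \<pi>])
  have sets_\<pi>: "sets \<pi> = sets lam" using \<pi> by (simp add: feasible_iff)
  have "integrable \<pi> c"
  proof (rule \<pi>.integrable_const_bound[where B = b])
    show "AE z in \<pi>. norm (c z) \<le> b"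
      using c_bounded sets_eq_imp_space_eq[OF sets_\<pi>] by (intro AE_I2) auto
    show "c \<in> borel_measurable \<pi>" using c_measurable sets_\<pi> by (simp cong: measurable_cong_sets)
  qed
  then have cf: "integrable lam (\<lambda>z. f z * c z)"
    unfolding \<pi>f[symmetric] by (subst (asm) integrable_density) (auto simp: f0)
  have int_c: "(\<integral>z. c z \<partial>\<pi>) = (\<integral>z. f z * c z \<partial>lam)"
    unfolding \<pi>f[symmetric] by (subst integral_density) (auto simp: f0)
  have neg: "(\<integral>\<^sup>+z. e2ennreal (- (ereal \<gamma> * \<Phi> (f z))) \<partial>lam) < \<infinity>"
  proof -
    obtain B where B: "\<And>t. 0 \<le> t \<Longrightarrow> ereal (- B) \<le> \<Phi> t"
      using quasi_young_superlinear_bounded_below[OF \<Phi> superlinear] by blast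
    have "ereal (- (\<gamma> * B)) \<le> ereal \<gamma> * \<Phi> (f z)" for z
      using ereal_mult_left_mono[OF B[OF f0], of "ereal \<gamma>" z] \<gamma> by simp
    then show ?thesis
      by (intro bounded_below_negative_part[OF lam.finite_measure_axioms, of "\<gamma> * B"])
  qed
  have "enn2ereal (energy f)
      = enn2ereal (\<integral>\<^sup>+z. e2ennreal (ereal (f z * c z + K) + ereal \<gamma> * \<Phi> (f z)) \<partial>lam)"
    by (simp add: energy_def tilted_integrand_def mult.commute)
  also have "\<dots> = ereal (\<integral>z. f z * c z + K \<partial>lam) + ereal_integral lam (\<lambda>z. ereal \<gamma> * \<Phi> (f z))"
    using cf neg K[OF c_bounded f0] by (intro ereal_integral_add_real) (auto simp: mult.commute)
  also have "(\<integral>z. f z * c z + K \<partial>lam) = (\<integral>z. c z \<partial>\<pi>) + K * measure lam (space lam)"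
    using cf by (simp add: int_c mult.commute)
  also have "ereal_integral lam (\<lambda>z. ereal \<gamma> * \<Phi> (f z)) = ereal \<gamma> * ereal_integral lam (\<lambda>z. \<Phi> (f z))"
    using \<gamma> negative_part_finite[of f, OF f0] by (intro ereal_integral_cmult) auto
  finally show ?thesis
    by (simp add: objective_eq f_def ac_simps flip: plus_ereal.simps(1))
qed

lemma objective_le_iff:
  assumes "\<pi> \<in> feasible" "\<pi>' \<in> feasible"
  shows "objective \<pi> \<le> objective \<pi>' \<longleftrightarrow> energy (dens lam \<pi>) \<le> energy (dens lam \<pi>')"
proof -
  have "objective \<pi> \<le> objective \<pi>' \<longleftrightarrow>
      objective \<pi> + ereal (K * measure lam (space lam)) \<le> objective \<pi>' + ereal (K * measure lam (space lam))"
    by (cases "objective \<pi>"; cases "objective \<pi>'") auto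
  then show ?thesis
    by (simp add: objective_eq_energy assms less_eq_ennreal.rep_eq)
qed

lemma objective_finite_iff:
  assumes "\<pi> \<in> feasible"
  shows "objective \<pi> < \<infinity> \<longleftrightarrow> energy (dens lam \<pi>) < \<infinity>"
proof -
  have "objective \<pi> < \<infinity> \<longleftrightarrow> objective \<pi> + ereal (K * measure lam (space lam)) < \<infinity>"
    by (cases "objective \<pi>") auto
  then show ?thesis
    by (simp add: objective_eq_energy assms less_ennreal.rep_eq)
qed

lemma energy_dens_density:
  assumes "f \<in> borel_measurable lam" "\<And>z. 0 \<le> f z"
  shows "energy (dens lam (density lam (\<lambda>z. ennreal (f z)))) = energy f"
proof -
  have "AE z in lam. dens lam (density lam (\<lambda>z. ennreal (f z))) z = f z"
    by (rule dens_density[OF P.sigma_finite_measure_axioms assms])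
  then have "AE z in lam. tilted_integrand \<Phi> \<gamma> c K z (dens lam (density lam (\<lambda>z. ennreal (f z))) z)
      = tilted_integrand \<Phi> \<gamma> c K z (f z)"
    by eventually_elim simp
  then show ?thesis unfolding energy_def by (rule nn_integral_cong_AE)
qed

text \<open>
  Minimization over measures is turned into minimization over densities, where the abstract results on
  superlinear energies apply.
\<close>

lemma minimizer_iff:
  "minimizer \<pi> \<longleftrightarrow> \<pi> \<in> feasible \<and> (\<forall>f\<in>couplings. energy (dens lam \<pi>) \<le> energy f)"
proof -
  have "(\<forall>\<pi>'\<in>feasible. energy (dens lam \<pi>) \<le> energy (dens lam \<pi>'))
      \<longleftrightarrow> (\<forall>f\<in>couplings. energy (dens lam \<pi>) \<le> energy f)"
  proof (intro iffI ballI)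
    fix f assume all: "\<forall>\<pi>'\<in>feasible. energy (dens lam \<pi>) \<le> energy (dens lam \<pi>')" and f: "f \<in> couplings"
    then have "density lam (\<lambda>z. ennreal (f z)) \<in> feasible"
      by (subst density_feasible_iff) (auto simp: densities_with_masses_def)
    then show "energy (dens lam \<pi>) \<le> energy f"
      using all energy_dens_density f by (metis (no_types, lifting) densities_with_masses_def mem_Collect_eq)
  qed (use dens_feasible in blast)
  then show ?thesis
    unfolding ot_minimizer_def is_arg_min_def
    by (auto simp: not_less objective_le_iff)
qed

lemma minimizer_exists:
  assumes "\<pi>0 \<in> feasible" "objective \<pi>0 < \<infinity>"
  shows "\<exists>\<pi>. minimizer \<pi>"
proof -
  have "energy (dens lam \<pi>0) < \<infinity>"
    using assms objective_finite_iff by blast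
  moreover have "emeasure (\<mu>1 \<Otimes>\<^sub>M \<mu>2) (space lam) < \<infinity>"
    by (simp add: indep.P.emeasure_eq_measure)
  ultimately obtain F where F: "F \<in> couplings" "\<And>f. f \<in> couplings \<Longrightarrow> energy F \<le> energy f"
    using energy_minimizer_exists[OF cylinders_sets space_cylinder cylinders_Compl _ dens_feasible[OF assms(1)]]
    by blast
  have meas: "F \<in> borel_measurable lam" "\<And>z. 0 \<le> F z"
    using F(1) by (auto simp: densities_with_masses_def)
  define \<pi> where "\<pi> = density lam (\<lambda>z. ennreal (F z))"
  have "energy (dens lam \<pi>) = energy F"
    unfolding \<pi>_def by (rule energy_dens_density[OF meas])
  moreover have "\<pi> \<in> feasible"
    unfolding \<pi>_def using density_feasible_iff[OF meas] F(1) by simp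
  ultimately show ?thesis
    using F(2) by (auto simp: minimizer_iff)
qed

lemma orlicz_space_if_objective_finite:
  assumes fin: "objective \<pi> < \<infinity>"
  shows "dens lam \<pi> \<in> orlicz_space \<Phi> lam"
proof (rule orlicz_space_if_positive_part_integrable[OF \<Phi> dens_measurable dens_nonneg])
  have "ereal_integral lam (\<lambda>z. \<Phi> (dens lam \<pi> z)) \<noteq> \<infinity>"
    using fin \<gamma> unfolding objective_eq by auto
  then show "(\<integral>\<^sup>+z. e2ennreal (\<Phi> (dens lam \<pi> z)) \<partial>lam) < \<infinity>"
    using negative_part_finite[of "dens lam \<pi>", OF dens_nonneg] unfolding ereal_integral_def
    by (cases "\<integral>\<^sup>+z. e2ennreal (\<Phi> (dens lam \<pi> z)) \<partial>lam";
        cases "\<integral>\<^sup>+z. e2ennreal (- \<Phi> (dens lam \<pi> z)) \<partial>lam") (auto simp: enn2ereal_ennreal)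
qed

lemma minimizer_unique:
  assumes "strictly_convex \<Phi>" and \<pi>: "minimizer \<pi>" and \<pi>': "minimizer \<pi>'" and fin: "objective \<pi> < \<infinity>"
  shows "\<pi> = \<pi>'"
proof -
  have feas: "\<pi> \<in> feasible" "\<pi>' \<in> feasible" using \<pi> \<pi>' by (auto simp: minimizer_iff)
  have "AE z in lam. dens lam \<pi> z = dens lam \<pi>' z"
  proof (rule energy_minimizer_unique[OF cylinders_sets])
    show "2 * tilted_integrand \<Phi> \<gamma> c K z ((s + t) / 2)
        < tilted_integrand \<Phi> \<gamma> c K z s + tilted_integrand \<Phi> \<gamma> c K z t"
      if "z \<in> space lam" "0 \<le> s" "0 \<le> t" "s \<noteq> t"
        "tilted_integrand \<Phi> \<gamma> c K z s < \<infinity>" "tilted_integrand \<Phi> \<gamma> c K z t < \<infinity>" for z s t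
      using that assms(1) \<Phi> \<gamma> K[OF c_bounded[OF that(1)]]
      by (intro tilted_integrand_strict_midpoint)
    show "energy (dens lam \<pi>) < \<infinity>" using fin objective_finite_iff feas by blast
  qed (use \<pi> \<pi>' feas dens_feasible in \<open>auto simp: minimizer_iff\<close>)
  then have "density lam (\<lambda>z. ennreal (dens lam \<pi> z)) = density lam (\<lambda>z. ennreal (dens lam \<pi>' z))"
    by (intro density_cong) auto
  then show ?thesis by (simp add: feasible_density_dens feas)
qed

lemma minimizer_objective:
  assumes "minimizer \<pi>"
  shows "objective \<pi> = ot_value \<Phi> \<gamma> c lam1 lam2 \<mu>1 \<mu>2"
  using assms unfolding ot_minimizer_def is_arg_min_def ot_value_def
  by (intro antisym INF_greatest INF_lower) (auto simp: not_less)

end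

theorem theorem3p4:
  fixes \<Omega>1 \<Omega>2 :: "(real ^ 'n) set"
    and lam1 lam2 \<mu>1 \<mu>2 :: "(real ^ 'n) measure"
    and c :: "(real ^ 'n) \<times> (real ^ 'n) \<Rightarrow> real"
    and \<gamma> :: real
    and \<Phi> :: "real \<Rightarrow> ereal"
  assumes "compact \<Omega>1" and "compact \<Omega>2"
    and "lam1 \<in> finite_measures_on \<Omega>1" and "spt lam1 = \<Omega>1"
    and "lam2 \<in> finite_measures_on \<Omega>2" and "spt lam2 = \<Omega>2"
    and "continuous_on (\<Omega>1 \<times> \<Omega>2) c"
    and "\<gamma> > 0"
    and "quasi_young \<Phi>"
    and "((\<lambda>t. \<Phi> t / ereal t) \<longlongrightarrow> \<infinity>) at_top"
    and "\<mu>1 \<in> prob_measures_on \<Omega>1" and "absolutely_continuous lam1 \<mu>1"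
    and "ereal_integrable lam1 (\<lambda>x. \<Phi> (dens lam1 \<mu>1 x))"
    and "\<mu>2 \<in> prob_measures_on \<Omega>2" and "absolutely_continuous lam2 \<mu>2"
    and "ereal_integrable lam2 (\<lambda>x. \<Phi> (dens lam2 \<mu>2 x))"
    and "ereal_integrable (lam1 \<Otimes>\<^sub>M lam2) (\<lambda>z. convex_conjugate (extend_inf \<Phi>) (- c z / \<gamma>))"
    and "dens lam1 \<mu>1 \<in> orlicz_space \<Phi> lam1 \<and> dens lam2 \<mu>2 \<in> orlicz_space \<Phi> lam2 \<longrightarrow>
         dens (lam1 \<Otimes>\<^sub>M lam2) (\<mu>1 \<Otimes>\<^sub>M \<mu>2) \<in> orlicz_space \<Phi> (lam1 \<Otimes>\<^sub>M lam2)"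
  shows "((\<exists>\<pi>. ot_minimizer \<Phi> \<gamma> c lam1 lam2 \<mu>1 \<mu>2 \<pi>) \<longleftrightarrow>
            dens lam1 \<mu>1 \<in> orlicz_space \<Phi> lam1 \<and> dens lam2 \<mu>2 \<in> orlicz_space \<Phi> lam2) \<and>
         (dens lam1 \<mu>1 \<in> orlicz_space \<Phi> lam1 \<and> dens lam2 \<mu>2 \<in> orlicz_space \<Phi> lam2 \<longrightarrow>
            (\<exists>\<pi>. ot_minimizer \<Phi> \<gamma> c lam1 lam2 \<mu>1 \<mu>2 \<pi> \<and>
                 dens (lam1 \<Otimes>\<^sub>M lam2) \<pi> \<in> orlicz_space \<Phi> (lam1 \<Otimes>\<^sub>M lam2))) \<and>
         (ot_value \<Phi> \<gamma> c lam1 lam2 \<mu>1 \<mu>2 < \<infinity> \<longrightarrow>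
            (\<forall>\<pi>. ot_minimizer \<Phi> \<gamma> c lam1 lam2 \<mu>1 \<mu>2 \<pi> \<longrightarrow>
                 dens (lam1 \<Otimes>\<^sub>M lam2) \<pi> \<in> orlicz_space \<Phi> (lam1 \<Otimes>\<^sub>M lam2)) \<and>
            (strictly_convex \<Phi> \<longrightarrow>
               (\<forall>\<pi> \<pi>'. ot_minimizer \<Phi> \<gamma> c lam1 lam2 \<mu>1 \<mu>2 \<pi> \<longrightarrow>
                       ot_minimizer \<Phi> \<gamma> c lam1 lam2 \<mu>1 \<mu>2 \<pi>' \<longrightarrow> \<pi> = \<pi>')))"
proof -
  have fin: "finite_measure lam1" "finite_measure lam2" and prob: "prob_space \<mu>1" "prob_space \<mu>2"
    and sets: "sets lam1 = sets (restrict_space borel \<Omega>1)" "sets lam2 = sets (restrict_space borel \<Omega>2)"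
      "sets \<mu>1 = sets (restrict_space borel \<Omega>1)" "sets \<mu>2 = sets (restrict_space borel \<Omega>2)"
    using assms(3,5,11,14) by (auto simp: finite_measures_on_def prob_measures_on_def)
  have space: "space lam1 = \<Omega>1" "space lam2 = \<Omega>2"
    using sets by (auto dest!: sets_eq_imp_space_eq simp: space_restrict_space)
  interpret transport_data lam1 \<mu>1 lam2 \<mu>2
    using fin prob sets space assms(12,15)
    by (auto simp: transport_data_def transport_data_axioms_def)
  have orlicz: "dens lam1 \<mu>1 \<in> orlicz_space \<Phi> lam1" "dens lam2 \<mu>2 \<in> orlicz_space \<Phi> lam2"
  proof -
    have "(\<integral>\<^sup>+x. e2ennreal (\<Phi> (dens \<nu> \<mu> x)) \<partial>\<nu>) < \<infinity>"
      if "ereal_integrable \<nu> (\<lambda>x. \<Phi> (dens \<nu> \<mu> x))" for \<nu> \<mu> :: "(real ^ 'n) measure"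
    proof -
      have "(\<integral>\<^sup>+x. e2ennreal (\<Phi> (dens \<nu> \<mu> x)) \<partial>\<nu>) \<le> (\<integral>\<^sup>+x. e2ennreal \<bar>\<Phi> (dens \<nu> \<mu> x)\<bar> \<partial>\<nu>)"
      proof (intro nn_integral_mono e2ennreal_mono)
        show "\<Phi> (dens \<nu> \<mu> x) \<le> \<bar>\<Phi> (dens \<nu> \<mu> x)\<bar>" for x
          by (cases "\<Phi> (dens \<nu> \<mu> x)") auto
      qed
      then show ?thesis using that by (auto simp: ereal_integrable_def intro: le_less_trans)
    qed
    then show "dens lam1 \<mu>1 \<in> orlicz_space \<Phi> lam1" "dens lam2 \<mu>2 \<in> orlicz_space \<Phi> lam2"
      using assms(9,13,16) by (auto intro!: orlicz_space_if_positive_part_integrable dens_nonneg)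
  qed
  have "compact (c ` (\<Omega>1 \<times> \<Omega>2))"
    using assms(1,2,7) by (intro compact_continuous_image compact_Times)
  then obtain b where b: "\<And>z. z \<in> \<Omega>1 \<times> \<Omega>2 \<Longrightarrow> \<bar>c z\<bar> \<le> b"
    using compact_imp_bounded bounded_iff by (metis imageI real_norm_def)
  obtain K where K: "\<And>a t. \<bar>a\<bar> \<le> b \<Longrightarrow> 0 \<le> t \<Longrightarrow> 0 \<le> ereal (a * t + K) + ereal \<gamma> * \<Phi> t"
    using quasi_young_tilt_bounded_below[OF assms(9,10,8)] by blast
  have "c \<in> borel_measurable (restrict_space borel (\<Omega>1 \<times> \<Omega>2))"
    by (rule borel_measurable_continuous_on_restrict[OF assms(7)])
  then have "c \<in> borel_measurable (lam1 \<Otimes>\<^sub>M lam2)"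
    using sets_lam by (simp add: space cong: measurable_cong_sets)
  then interpret regularized_transport lam1 \<mu>1 lam2 \<mu>2 \<Phi> \<gamma> b K c
    using assms(8-10) b K by unfold_locales (auto simp: space_pair_measure space)
  \<comment> \<open>the direct method needs a coupling of finite objective; otherwise every coupling is a minimizer\<close>
  have ex: "\<exists>\<pi>. minimizer \<pi> \<and> dens lam \<pi> \<in> orlicz_space \<Phi> lam"
  proof (cases "ot_value \<Phi> \<gamma> c lam1 lam2 \<mu>1 \<mu>2 < \<infinity>")
    case True
    then obtain \<pi>0 where "\<pi>0 \<in> feasible" "objective \<pi>0 < \<infinity>"
      unfolding ot_value_def INF_less_iff by blast
    then obtain \<pi> where "minimizer \<pi>" using minimizer_exists by blast
    then show ?thesis
      using True orlicz_space_if_objective_finite minimizer_objective by metis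
  next
    case False
    have "objective \<pi> = \<infinity>" if "\<pi> \<in> feasible" for \<pi>
      using False INF_lower[OF that, of objective] by (auto simp: ot_value_def)
    then have "minimizer (\<mu>1 \<Otimes>\<^sub>M \<mu>2)"
      using indep_feasible by (auto simp: ot_minimizer_def is_arg_min_def)
    then show ?thesis using assms(18) orlicz by blast
  qed
  have "dens lam \<pi> \<in> orlicz_space \<Phi> lam"
    if "ot_value \<Phi> \<gamma> c lam1 lam2 \<mu>1 \<mu>2 < \<infinity>" "minimizer \<pi>" for \<pi>
    using that orlicz_space_if_objective_finite minimizer_objective by metis
  moreover have "\<pi> = \<pi>'"
    if "ot_value \<Phi> \<gamma> c lam1 lam2 \<mu>1 \<mu>2 < \<infinity>" "strictly_convex \<Phi>" "minimizer \<pi>" "minimizer \<pi>'" for \<pi> \<pi>'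
    using that minimizer_unique minimizer_objective by metis
  ultimately show ?thesis
    using ex orlicz by blast
qed

end
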